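(* For each $d\ge 2$ there is a stationary and directed ancestral function $(a(x))_{x\in\mathbb{Z}^d}$ that is polynomially mixing of order $1$ and for which $$\limsup_{n\to\infty} n^{d-1}\,\mathbb{P}[h(0)\ge n]<\infty .$$
   Context: An ancestral function is a random function $a:\mathbb{Z}^d\to\mathbb{Z}^d$ (defined on a probability space with measure $\mathbb{P}$) such that $x$ and $a(x)$ are always nearest neighbors, $a(a(x))\ne x$ for all $x$, and the set of edges $F_a=\{\{x,a(x)\}: x\in\mathbb{Z}^d\}$ defines a forest, i.e. the graph $(\mathbb{Z}^d,F_a)$ has no cycles. Write $a^0(x)=x$ and $a^n(x)=a(a^{n-1}(x))$ for $n\ge1$. It is stationary if the collection $(a(x)-x)_{x\in\mathbb{Z}^d}$ is stationary with respect to the translations of $\mathbb{Z}^d$. It is directed if for some $z\in\{\pm1\}^d$, $\mathbb{P}$-a.s., $a(x)-x\in\{z_ie_i: i=1,\dots,d\}$ for all $x\in\mathbb{Z}^d$, where $e_1,\dots,e_d$ is the standard basis. Define $$h(x)=\sup\{n\ge 0 : x=a^n(y)\text{ for some }y\in\mathbb{Z}^d\},\qquad x\in\mathbb{Z}^d.$$ Mixing: $|\cdot|$ is the $1$-norm. For a family $b=(b(y))_{y\in\mathbb{Z}^d}$ of random variables on a common probability space and $G\subset\mathbb{Z}^d$, let $\mathcal{M}_G^b$ be the set of real-valued random variables $f$ with $|f|\le1$ that are measurable with respect to $\sigma(b(y),y\in G)$. For $\gamma>0$, $b$ is polynomially mixing of order $\gamma$ if for all finite $G\subset\mathbb{Z}^d$,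 $$\sup_{s\in\mathbb{Z}^d}\ \sup_{f\in\mathcal{M}_G^b,\ g\in\mathcal{M}_{G+s}^b}|s|^\gamma\,|\operatorname{cov}(f,g)|<\infty .$$ *)

theory Defs
  imports "HOL-Probability.Probability"
begin

text \<open>The lattice is the type \<open>int ^ 'd\<close>; its dimension is \<open>CARD('d)\<close>.\<close>

definition norm1 :: "int ^ 'd \<Rightarrow> int" where
  "norm1 x = (\<Sum>i\<in>UNIV. \<bar>x $ i\<bar>)"

definition nearest_neighbors :: "int ^ 'd \<Rightarrow> int ^ 'd \<Rightarrow> bool" where
  "nearest_neighbors x y \<longleftrightarrow> norm1 (x - y) = 1"

definition edges :: "('v \<Rightarrow> 'v) \<Rightarrow> 'v set set" where
  "edges \<alpha> = {{x, \<alpha> x} | x. True}"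

text \<open>A cycle of a simple undirected graph is given by its at least three pairwise distinct
  vertices, listed in cyclic order.\<close>

definition is_cycle :: "'v set set \<Rightarrow> 'v list \<Rightarrow> bool" where
  "is_cycle E p \<longleftrightarrow> 3 \<le> length p \<and> distinct p \<and>
     (\<forall>i<length p. {p ! i, p ! (Suc i mod length p)} \<in> E)"

definition is_forest :: "'v set set \<Rightarrow> bool" where
  "is_forest E \<longleftrightarrow> \<not> (\<exists>p. is_cycle E p)"

text \<open>A random function is a family of random variables \<open>a x :: 'w \<Rightarrow> int ^ 'd\<close>. The values
  lie in a countable set, which carries the discrete sigma-algebra.\<close>

definition ancestral_function ::
    "'w measure \<Rightarrow> (int ^ 'd \<Rightarrow> 'w \<Rightarrow> int ^ 'd) \<Rightarrow> bool" where
  "ancestral_function M a \<longleftrightarrow>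
     (\<forall>x. a x \<in> measurable M (count_space UNIV)) \<and>
     (\<forall>\<omega>\<in>space M.
        (\<forall>x. nearest_neighbors x (a x \<omega>)) \<and>
        (\<forall>x. a (a x \<omega>) \<omega> \<noteq> x) \<and>
        is_forest (edges (\<lambda>x. a x \<omega>)))"

definition stationary ::
    "'w measure \<Rightarrow> (int ^ 'd \<Rightarrow> 'w \<Rightarrow> int ^ 'd) \<Rightarrow> bool" where
  "stationary M a \<longleftrightarrow>
     (\<forall>s. distr M (PiM UNIV (\<lambda>_. count_space UNIV)) (\<lambda>\<omega> x. a (x + s) \<omega> - (x + s)) =
          distr M (PiM UNIV (\<lambda>_. count_space UNIV)) (\<lambda>\<omega> x. a x \<omega> - x))"

definition directed ::
    "'w measure \<Rightarrow> (int ^ 'd \<Rightarrow> 'w \<Rightarrow> int ^ 'd) \<Rightarrow> bool" where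
  "directed M a \<longleftrightarrow>
     (\<exists>z :: int ^ 'd. (\<forall>i. z $ i \<in> {1, -1}) \<and>
        (AE \<omega> in M. \<forall>x. a x \<omega> - x \<in> {z $ i *s axis i 1 | i. True}))"

definition ancestral_height :: "('v \<Rightarrow> 'v) \<Rightarrow> 'v \<Rightarrow> enat" where
  "ancestral_height \<alpha> x = Sup {enat n | n. \<exists>y. x = (\<alpha> ^^ n) y}"

definition generated_algebra ::
    "'w measure \<Rightarrow> 'b measure \<Rightarrow> ('i \<Rightarrow> 'w \<Rightarrow> 'b) \<Rightarrow> 'i set \<Rightarrow> 'w measure" where
  "generated_algebra M N b G =
     sigma (space M) {b y -` A \<inter> space M | y A. y \<in> G \<and> A \<in> sets N}"

definition local_observables ::
    "'w measure \<Rightarrow> 'b measure \<Rightarrow> ('i \<Rightarrow> 'w \<Rightarrow> 'b) \<Rightarrow> 'i set \<Rightarrow> ('w \<Rightarrow> real) set" where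
  "local_observables M N b G =
     {f \<in> borel_measurable (generated_algebra M N b G). \<forall>\<omega>\<in>space M. \<bar>f \<omega>\<bar> \<le> 1}"

definition cov :: "'w measure \<Rightarrow> ('w \<Rightarrow> real) \<Rightarrow> ('w \<Rightarrow> real) \<Rightarrow> real" where
  "cov M f g = integral\<^sup>L M (\<lambda>\<omega>. (f \<omega> - integral\<^sup>L M f) * (g \<omega> - integral\<^sup>L M g))"

text \<open>The supremum is taken in the extended reals, so that it is infinite when the
  set is unbounded. The space of values of \<open>b\<close> is \<open>N\<close>.\<close>

definition polynomially_mixing ::
    "'w measure \<Rightarrow> 'b measure \<Rightarrow> (int ^ 'd \<Rightarrow> 'w \<Rightarrow> 'b) \<Rightarrow> real \<Rightarrow> bool" where
  "polynomially_mixing M N b \<gamma> \<longleftrightarrow>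
     (\<forall>G. finite G \<longrightarrow>
        (SUP s. SUP f \<in> local_observables M N b G.
           SUP g \<in> local_observables M N b ((\<lambda>x. x + s) ` G).
             ereal (real_of_int (norm1 s) powr \<gamma> * \<bar>cov M f g\<bar>)) < \<infinity>)"

end

theory Submission
  imports Defs
begin

text \<open>Give every site, for each scale \<open>k\<close>, an independent uniform label, and call the direction \<open>i\<close>
  blocked at \<open>x\<close> by scale \<open>k\<close> if the site of minimal label in the box \<open>x + [0, 2^k)^d\<close> changes, or may
  change, when the box is moved by \<open>e_i\<close>. A path of steps that are not blocked by scale \<open>k\<close> keeps
  the same minimising site in its boxes and therefore has fewer than \<open>d 2^k\<close> steps. The probability
  that all directions in a set \<open>I\<close> are blocked by scale \<open>k\<close> is of order \<open>2^(-k |I|)\<close>.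

  Call \<open>x\<close> trapped at scale \<open>k\<close> if each direction is blocked by some scale \<open>j \<ge> k\<close>. The scales
  are independent, so this has probability of order \<open>2^(-k d)\<close>. Let \<open>a(x)\<close> be a step in a direction that
  is blocked by no scale \<open>j \<ge> k\<close>, for the least \<open>k\<close> for which there is one. A path of length \<open>d 2^k\<close>
  must visit a site trapped at scale \<open>k\<close>. Hence if the origin has an ancestral line of length
  \<open>n \<ge> d 2^k\<close>, then one of the last \<open>d 2^k\<close> sites before the origin is trapped, which by
  stationarity has probability at most \<open>d 2^k\<close> times that of a trapped origin, i.e. of order
  \<open>2^(-k (d - 1))\<close>.

  The scales above \<open>K\<close> influence \<open>a(x)\<close> with probability of order \<open>2^(-K)\<close> only, and the
  function built from the scales up to \<open>K\<close> has dependence range of order \<open>2^K\<close>; this is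
  polynomial mixing of order 1.\<close>

section \<open>Unblocked directions and trapped sites\<close>

lemma sum_axis [simp]: "(\<Sum>i\<in>UNIV. axis k (1::int) $ i) = 1"
  by (simp add: axis_def if_distrib cong: if_cong)

text \<open>Each step raises the coordinate sum by one, so two steps never return. On a cycle, both
  neighbours of a vertex of least level would have to be its image under \<open>\<alpha>\<close>,
  but they are distinct.\<close>

lemma directed_step:
  fixes \<alpha> :: "int ^ 'd \<Rightarrow> int ^ 'd"
  assumes step: "\<And>x. \<exists>i. \<alpha> x = x + axis i 1"
  shows "nearest_neighbors x (\<alpha> x)" and "\<alpha> (\<alpha> x) \<noteq> x" and "is_forest (edges \<alpha>)"
proof -
  define level :: "int ^ 'd \<Rightarrow> int" where "level x = (\<Sum>i\<in>UNIV. x $ i)" for x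
  have level_step: "level (\<alpha> x) = level x + 1" for x
    using step[of x] by (auto simp: level_def sum.distrib)
  obtain i where "\<alpha> x = x + axis i 1" using step by blast
  then have "norm1 (x - \<alpha> x) = (\<Sum>k\<in>UNIV. axis i (1::int) $ k)"
    unfolding norm1_def by (intro sum.cong) (auto simp: axis_def)
  then show "nearest_neighbors x (\<alpha> x)"
    by (simp add: nearest_neighbors_def)
  have "level (\<alpha> (\<alpha> x)) = level x + 2" by (simp add: level_step)
  then show "\<alpha> (\<alpha> x) \<noteq> x" by (metis add_cancel_right_right zero_neq_numeral)
  show "is_forest (edges \<alpha>)"
    unfolding is_forest_def
  proof
    assume "\<exists>p. is_cycle (edges \<alpha>) p"
    then obtain p where len: "3 \<le> length p" and dist: "distinct p"
      and E: "\<And>i. i < length p \<Longrightarrow> {p ! i, p ! (Suc i mod length p)} \<in> edges \<alpha>"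
      unfolding is_cycle_def by blast
    define n where "n = length p"
    have "{..<n} \<noteq> {}" using len by (auto simp: n_def lessThan_empty_iff)
    from arg_min_if_finite[OF finite_lessThan this, of "\<lambda>i. level (p ! i)"]
    obtain i where i: "i < n" and low: "\<And>j. j < n \<Longrightarrow> level (p ! i) \<le> level (p ! j)"
      by (auto simp: not_less)
    have up: "p ! j = \<alpha> (p ! i)" if "j < n" "{p ! i, p ! j} \<in> edges \<alpha>" for j
    proof -
      obtain x where "{p ! i, p ! j} = {x, \<alpha> x}" using \<open>_ \<in> edges \<alpha>\<close> unfolding edges_def by blast
      then have "p ! i = x \<and> p ! j = \<alpha> x \<or> p ! i = \<alpha> x \<and> p ! j = x"
        by (metis doubleton_eq_iff)
      then show ?thesis using low[OF \<open>j < n\<close>] level_step[of x] by auto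
    qed
    define j where "j = Suc i mod n"
    define l where "l = (if i = 0 then n - 1 else i - 1)"
    have n3: "3 \<le> n" using len n_def by simp
    have j: "j < n" "{p ! i, p ! j} \<in> edges \<alpha>"
      using E[of i] i n3 by (simp_all add: j_def n_def[symmetric])
    have l: "l < n" "Suc l mod n = i" using i n3 by (auto simp: l_def)
    then have "{p ! i, p ! l} \<in> edges \<alpha>" using E[of l] by (simp add: n_def insert_commute)
    then have "p ! j = p ! l" using up[OF j] up[OF l(1)] by simp
    then have "j = l" using dist j l by (simp add: n_def nth_eq_iff_index_eq)
    moreover have "j \<noteq> l"
      using i n3 by (cases "Suc i = n") (auto simp: j_def l_def split: if_splits)
    ultimately show False by simp
  qed
qed

section \<open>Blocking, the parent map and its paths\<close>

definition window :: "nat \<Rightarrow> int ^ 'd \<Rightarrow> (int ^ 'd) set" where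
  "window L x = {c. \<forall>i. x $ i \<le> c $ i \<and> c $ i < x $ i + int L}"

definition leader :: "('v \<Rightarrow> real) \<Rightarrow> 'v set \<Rightarrow> 'v \<Rightarrow> bool" where
  "leader u S c \<longleftrightarrow> c \<in> S \<and> (\<forall>c'\<in>S - {c}. u c < u c')"

text \<open>For a fixed scale \<open>k\<close>, sites whose windows have the same leader form a cell of diameter of
  order \<open>2 ^ k\<close>; an unblocked step stays in the cell. Asking for a strict leader of the union of
  the two windows settles ties between labels without breaking translation invariance.\<close>

definition blocked :: "(nat \<times> (int ^ 'd) \<Rightarrow> real) \<Rightarrow> nat \<Rightarrow> 'd \<Rightarrow> int ^ 'd \<Rightarrow> bool" where
  "blocked \<omega> k i x \<longleftrightarrow>
     \<not> (\<exists>c\<in>window (2 ^ k) x \<inter> window (2 ^ k) (x + axis i 1).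
          leader (\<lambda>c. \<omega> (k, c)) (window (2 ^ k) x \<union> window (2 ^ k) (x + axis i 1)) c)"

definition trapped :: "(nat \<times> (int ^ 'd) \<Rightarrow> real) \<Rightarrow> nat \<Rightarrow> int ^ 'd \<Rightarrow> bool" where
  "trapped \<omega> k x \<longleftrightarrow> (\<forall>i. \<exists>j\<ge>k. blocked \<omega> j i x)"

text \<open>Almost surely some \<open>k\<close> as in the \<open>LEAST\<close> exists; otherwise the direction is arbitrary, and
  the site in question is trapped at every scale.\<close>

definition escape :: "(nat \<Rightarrow> 'd \<Rightarrow> bool) \<Rightarrow> 'd" where
  "escape B = (SOME i. \<forall>j\<ge>(LEAST k. \<exists>i. \<forall>j\<ge>k. \<not> B j i). \<not> B j i)"

definition parent :: "(nat \<times> (int ^ 'd) \<Rightarrow> real) \<Rightarrow> int ^ 'd \<Rightarrow> int ^ 'd" where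
  "parent \<omega> x = x + axis (escape (\<lambda>k i. blocked \<omega> k i x)) 1"

text \<open>The least admissible scale is at most \<open>k\<close>, so the direction chosen for it
  is free at scale \<open>k\<close> too. Defining \<open>escape\<close> through the least scale
  makes one choice serve every scale at which the site is not trapped.\<close>

lemma escape_unblocked:
  assumes "\<exists>i. \<forall>j\<ge>k. \<not> B j i"
  shows "\<not> B k (escape B)"
proof -
  let ?k = "LEAST k. \<exists>i. \<forall>j\<ge>k. \<not> B j i"
  have "\<exists>i. \<forall>j\<ge>?k. \<not> B j i" by (rule LeastI[of _ k]) (rule assms)
  then have "\<forall>j\<ge>?k. \<not> B j (escape B)" unfolding escape_def by (rule someI_ex)
  moreover have "?k \<le> k" by (rule Least_le) (rule assms)
  ultimately show ?thesis by blast
qed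

lemma leader_subset: "leader u S c \<Longrightarrow> c \<in> S' \<Longrightarrow> S' \<subseteq> S \<Longrightarrow> leader u S' c"
  unfolding leader_def by blast

lemma leader_unique: "leader u S c \<Longrightarrow> leader u S c' \<Longrightarrow> c = c'"
  unfolding leader_def by (metis DiffI empty_iff insertE less_asym)

text \<open>A site that leads the union of two windows and lies in both of them leads each one, so
  an unblocked step keeps the leader.\<close>

lemma untrapped_leader:
  assumes "\<not> trapped \<omega> k x"
  shows "\<exists>c. leader (\<lambda>c. \<omega> (k, c)) (window (2 ^ k) x) c \<and>
             leader (\<lambda>c. \<omega> (k, c)) (window (2 ^ k) (parent \<omega> x)) c"
proof -
  let ?i = "escape (\<lambda>k i. blocked \<omega> k i x)"
  have "\<not> blocked \<omega> k ?i x"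
    using assms unfolding trapped_def by (intro escape_unblocked) blast
  then show ?thesis
    unfolding blocked_def parent_def by (auto intro: leader_subset)
qed

lemma level_parent_funpow:
  "(\<Sum>i\<in>UNIV. ((parent \<omega> ^^ n) x) $ i) = (\<Sum>i\<in>UNIV. x $ i) + int n"
  by (induction n) (auto simp: parent_def sum.distrib)

text \<open>If the first d 2^k sites were untrapped, uniqueness would carry one leader along the
  whole path, and the windows at both ends would contain it. Each coordinate would then grow by at
  most 2^k - 1, too little for d 2^k steps.\<close>

lemma path_hits_trapped:
  fixes y :: "int ^ 'd"
  shows "\<exists>m < CARD('d) * 2 ^ k. trapped \<omega> k ((parent \<omega> ^^ m) y)"
proof (rule ccontr)
  let ?lead = "\<lambda>x. leader (\<lambda>c. \<omega> (k, c)) (window (2 ^ k) x)"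
  define n where "n = CARD('d) * 2 ^ k"
  assume "\<not> ?thesis"
  then have free: "\<not> trapped \<omega> k ((parent \<omega> ^^ m) y)" if "m < n" for m
    using that by (auto simp: n_def)
  have n0: "0 < n" by (simp add: n_def)
  obtain c where c: "?lead y c" using untrapped_leader[OF free[OF n0]] by auto
  have "?lead ((parent \<omega> ^^ m) y) c" if "m \<le> n" for m
    using that
  proof (induction m)
    case (Suc m)
    then show ?case
      using untrapped_leader[OF free[of m]] leader_unique by fastforce
  qed (simp add: c)
  then have "?lead ((parent \<omega> ^^ n) y) c" by simp
  then have "c \<in> window (2 ^ k) y" "c \<in> window (2 ^ k) ((parent \<omega> ^^ n) y)"
    using c by (auto simp: leader_def)
  then have "((parent \<omega> ^^ n) y) $ i \<le> c $ i" "c $ i < y $ i + 2 ^ k" for i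
    by (simp_all add: window_def)
  then have "((parent \<omega> ^^ n) y) $ i \<le> y $ i + (2 ^ k - 1)" for i
    by (smt (verit))
  then have "(\<Sum>i\<in>UNIV. ((parent \<omega> ^^ n) y) $ i) \<le> (\<Sum>i\<in>UNIV. y $ i + (2 ^ k - 1))"
    by (intro sum_mono)
  then have "int n \<le> int CARD('d) * (2 ^ k - 1)"
    by (simp add: level_parent_funpow sum.distrib)
  also have "\<dots> < int n" by (simp add: n_def right_diff_distrib)
  finally show False by simp
qed

section \<open>Translation equivariance\<close>

definition translate :: "int ^ 'd \<Rightarrow> (nat \<times> (int ^ 'd) \<Rightarrow> real) \<Rightarrow> (nat \<times> (int ^ 'd) \<Rightarrow> real)" where
  "translate s \<omega> = (\<lambda>(k, c). \<omega> (k, c + s))"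

lemma translate_apply [simp]: "translate s \<omega> (k, c) = \<omega> (k, c + s)"
  by (simp add: translate_def)

lemma window_translate: "window L (x + s) = (\<lambda>c. c + s) ` window L x"
proof (intro set_eqI iffI)
  fix c assume "c \<in> window L (x + s)"
  then have "c - s \<in> window L x" unfolding window_def by (auto simp: algebra_simps)
  then show "c \<in> (\<lambda>c. c + s) ` window L x" by (metis diff_add_cancel image_eqI)
qed (auto simp: window_def)

lemma leader_image:
  assumes "inj f"
  shows "leader u (f ` S) (f c) \<longleftrightarrow> leader (\<lambda>c. u (f c)) S c"
  using assms unfolding leader_def by (auto simp: inj_image_mem_iff dest: injD)

lemma blocked_translate: "blocked (translate s \<omega>) k i x \<longleftrightarrow> blocked \<omega> k i (x + s)"
proof -
  have *: "window L (x + s + axis i 1) = (\<lambda>c. c + s) ` window L (x + axis i 1)" for L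
    by (metis window_translate add.assoc add.commute)
  have inj: "inj (\<lambda>c. c + s)" by (simp add: inj_def)
  show ?thesis
    unfolding blocked_def * unfolding window_translate image_Un[symmetric] 
      image_Int[OF inj, symmetric] by (simp add: leader_image[OF inj])
qed

lemma trapped_translate: "trapped (translate s \<omega>) k x \<longleftrightarrow> trapped \<omega> k (x + s)"
  by (simp add: trapped_def blocked_translate)

text \<open>The choice in \<open>escape\<close> depends only on the pattern of blocked scales and
  directions, not on the site itself.\<close>

lemma parent_translate: "parent (translate s \<omega>) x = parent \<omega> (x + s) - s"
  by (simp add: parent_def blocked_translate)

lemma parent_funpow_translate:
  "(parent (translate s \<omega>) ^^ n) x = (parent \<omega> ^^ n) (x + s) - s"
  by (induction n) (simp_all add: parent_translate)

section \<open>Random labels\<close>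

definition noise :: "('i \<Rightarrow> real) measure" where
  "noise = PiM UNIV (\<lambda>_. uniform_measure lborel {0..1})"

lemma prob_space_uniform: "prob_space (uniform_measure lborel {0..1::real})"
  by (rule prob_space_uniform_measure) auto

interpretation noise: prob_space noise
  unfolding noise_def by (rule prob_space_PiM) (rule prob_space_uniform)

interpretation noise_product: product_prob_space "\<lambda>_. uniform_measure lborel {0..1::real}" UNIV
  by (simp add: product_prob_space_def product_prob_space_axioms_def product_sigma_finite_def
      prob_space_uniform prob_space_imp_sigma_finite)

lemma space_noise [simp]: "space noise = UNIV"
  by (simp add: noise_def space_PiM)

lemma noise_component [measurable]: "(\<lambda>\<omega>. \<omega> p) \<in> borel_measurable noise"
  unfolding noise_def by measurable

lemma sets_noise_cylinder:
  assumes "finite P" "\<And>p. p \<in> P \<Longrightarrow> E p \<in> sets borel"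
  shows "{\<omega>. \<forall>p\<in>P. \<omega> p \<in> E p} \<in> sets noise"
proof -
  have "{\<omega> \<in> space noise. \<forall>p\<in>P. \<omega> p \<in> E p} \<in> sets noise"
    using assms by (intro sets.sets_Collect_finite_All measurable_sets_Collect[OF noise_component]) auto
  then show ?thesis by simp
qed

lemma measure_noise_cylinder:
  assumes "finite P" "\<And>p. p \<in> P \<Longrightarrow> E p \<in> sets borel"
  shows "measure noise {\<omega>. \<forall>p\<in>P. \<omega> p \<in> E p} =
           (\<Prod>p\<in>P. measure (uniform_measure lborel {0..1}) (E p))"
  using noise_product.emeasure_PiM_Collect[of P E] assms
  unfolding noise_def[symmetric] space_noise
  by (simp add: noise.emeasure_eq_measure noise_product.M.emeasure_eq_measure
      prod_ennreal measure_nonneg prod_nonneg)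

lemma measure_uniform_atMost:
  assumes "0 \<le> t" shows "measure (uniform_measure lborel {0..1::real}) {..t} \<le> t"
proof -
  have "measure (uniform_measure lborel {0..1}) {..t} = measure lborel ({0..1} \<inter> {..t})"
    by (subst measure_uniform_measure) auto
  also have "\<dots> \<le> measure lborel {0..t}"
    using assms by (intro measure_mono_fmeasurable) (auto simp: fmeasurable_def)
  finally show ?thesis using assms by simp
qed

lemma measure_uniform_atLeast:
  assumes "0 \<le> t" "t \<le> 1" shows "measure (uniform_measure lborel {0..1::real}) {t..} = 1 - t"
proof -
  have "measure (uniform_measure lborel {0..1}) {t..} = measure lborel ({0..1} \<inter> {t..})"
    by (subst measure_uniform_measure) auto
  also have "{0..1} \<inter> {t..} = {t..1}" using assms by auto
  finally show ?thesis using assms by simp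
qed

lemma measure_uniform_Icc:
  assumes "s \<le> t" shows "measure (uniform_measure lborel {0..1::real}) {s..t} \<le> t - s"
proof -
  have "measure (uniform_measure lborel {0..1}) {s..t} = measure lborel ({0..1} \<inter> {s..t})"
    by (subst measure_uniform_measure) auto
  also have "\<dots> \<le> measure lborel {s..t}"
    using assms by (intro measure_mono_fmeasurable) (auto simp: fmeasurable_def)
  finally show ?thesis using assms by simp
qed

lemma AE_noise_unit: "AE \<omega> in noise. \<omega> p \<in> {0..1}"
  unfolding noise_def
  by (intro AE_PiM_component prob_space_uniform AE_uniform_measureI) auto

text \<open>Cover the unit interval by intervals of length 1 / N. Equal labels lie in a common
  interval, an event of probability of order 1 / N, and N is arbitrary.\<close>

lemma AE_noise_distinct:
  assumes "p \<noteq> q" shows "AE \<omega> in noise. \<omega> p \<noteq> \<omega> q"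
proof -
  define T where "T = {\<omega> \<in> space noise. \<omega> p = \<omega> q}"
  have T [measurable]: "T \<in> sets noise" unfolding T_def by measurable
  have bound: "measure noise T \<le> 2 * inverse (real (Suc n))" for n
  proof -
    define N where "N = Suc n"
    have N0: "0 < N" by (simp add: N_def)
    define A where "A i = {\<omega>. \<forall>r\<in>{p, q}. \<omega> r \<in> {real i / N .. (real i + 1) / N}}" for i
    have A [measurable]: "A i \<in> sets noise" for i
      unfolding A_def by (intro sets_noise_cylinder) auto
    have "AE \<omega> in noise. \<omega> \<in> T \<longrightarrow> \<omega> \<in> (\<Union>i\<in>{..N}. A i)"
      using AE_noise_unit[of p]
    proof eventually_elim
      case (elim \<omega>)
      show ?case
      proof
        assume "\<omega> \<in> T"
        then have eq: "\<omega> q = \<omega> p" by (simp add: T_def)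
        \<comment> \<open>The index N occurs when the label is 1, hence the union over
          \<open>{..N}\<close>.\<close>
        define i where "i = nat \<lfloor>N * \<omega> p\<rfloor>"
        have "real i \<le> N * \<omega> p" "N * \<omega> p < real i + 1"
          using elim by (auto simp: i_def)
        moreover have "N * \<omega> p \<le> N" using elim by (simp add: mult_left_le)
        ultimately have "real i \<le> real N" "\<omega> \<in> A i"
          using N0 by (linarith, auto simp: A_def eq field_simps)
        then show "\<omega> \<in> (\<Union>i\<in>{..N}. A i)" by auto
      qed
    qed
    then have "measure noise T \<le> measure noise (\<Union>i\<in>{..N}. A i)"
      by (rule noise.finite_measure_mono_AE) measurable
    also have "\<dots> \<le> (\<Sum>i\<in>{..N}. measure noise (A i))"
      by (intro measure_UNION_le) auto
    also have "\<dots> \<le> (\<Sum>i\<in>{..N}. (1 / N)\<^sup>2)"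
    proof (intro sum_mono)
      fix i
      have "measure noise (A i) = (measure (uniform_measure lborel {0..1}) {real i / N .. (real i + 1) / N})\<^sup>2"
        unfolding A_def using assms
        by (subst measure_noise_cylinder) (auto simp: power2_eq_square)
      also have "\<dots> \<le> ((real i + 1) / N - real i / N)\<^sup>2"
        by (intro power_mono measure_uniform_Icc) (auto simp: divide_right_mono)
      finally show "measure noise (A i) \<le> (1 / N)\<^sup>2"
        by (simp add: diff_divide_distrib[symmetric])
    qed
    also have "\<dots> = (real N + 1) / N\<^sup>2" by (simp add: power_divide)
    also have "\<dots> \<le> 2 * inverse (real N)"
      using N0 by (simp add: field_simps power2_eq_square)
    finally show ?thesis by (simp add: N_def)
  qed
  have "(\<lambda>n. 2 * inverse (real (Suc n))) \<longlonglongrightarrow> 0"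
    using LIMSEQ_inverse_real_of_nat by (rule tendsto_mult_right_zero)
  then have "measure noise T \<le> 0"
    by (rule LIMSEQ_le_const) (use bound in blast)
  then have "T \<in> null_sets noise"
    using T by (simp add: noise.emeasure_eq_measure null_sets_def measure_le_0_iff)
  then show ?thesis
    by (rule AE_I') (auto simp: T_def)
qed

lemma AE_noise_inj:
  "AE \<omega> in noise. inj (\<omega> :: 'i::countable \<Rightarrow> real)"
proof -
  have "AE \<omega> in noise. \<forall>p q. p \<noteq> q \<longrightarrow> \<omega> p \<noteq> \<omega> (q :: 'i)"
    unfolding AE_all_countable by (intro allI AE_impI AE_noise_distinct)
  then show ?thesis by eventually_elim (auto simp: inj_def)
qed

section \<open>Boxes, faces and slices\<close>

lemma card_vec_box:
  fixes A :: "'d::finite \<Rightarrow> 'b set"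
  shows "card {c. \<forall>i. c $ i \<in> A i} = (\<Prod>i\<in>UNIV. card (A i))"
proof -
  have "bij_betw vec_nth {c. \<forall>i. c $ i \<in> A i} (PiE UNIV A)"
    by (rule bij_betwI[where g = vec_lambda]) auto
  then show ?thesis by (simp add: bij_betw_same_card card_PiE)
qed

lemma finite_vec_box:
  fixes A :: "'d::finite \<Rightarrow> 'b set"
  assumes "\<And>i. finite (A i)"
  shows "finite {c. \<forall>i. c $ i \<in> A i}"
proof -
  have "bij_betw vec_nth {c. \<forall>i. c $ i \<in> A i} (PiE UNIV A)"
    by (rule bij_betwI[where g = vec_lambda]) auto
  then show ?thesis using assms by (simp add: bij_betw_finite finite_PiE)
qed

lemma window_eq: "window L x = {c. \<forall>i. c $ i \<in> {x $ i..<x $ i + int L}}"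
  by (simp add: window_def)

lemma finite_window [simp]: "finite (window L x)"
  unfolding window_eq by (rule finite_vec_box) simp

lemma card_window: "card (window L (x :: int ^ 'd)) = L ^ CARD('d)"
  unfolding window_eq card_vec_box by simp

lemma card_window_face:
  fixes x :: "int ^ 'd"
  shows "card {c \<in> window L x. \<forall>i\<in>J. c $ i = x $ i} \<le> L ^ (CARD('d) - card J)"
proof -
  have "{c \<in> window L x. \<forall>i\<in>J. c $ i = x $ i} \<subseteq>
        {c. \<forall>i. c $ i \<in> (if i \<in> J then {x $ i} else {x $ i..<x $ i + int L})}"
    by (auto simp: window_def)
  then have "card {c \<in> window L x. \<forall>i\<in>J. c $ i = x $ i} \<le>
        card {c. \<forall>i. c $ i \<in> (if i \<in> J then {x $ i} else {x $ i..<x $ i + int L})}"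
    by (intro card_mono finite_vec_box) auto
  also have "\<dots> = (\<Prod>i\<in>UNIV. if i \<in> J then 1 else L)"
    unfolding card_vec_box by (intro prod.cong) auto
  also have "\<dots> = L ^ card (- J)"
    by (simp add: prod.If_cases Compl_eq_Diff_UNIV)
  finally show ?thesis by (simp add: Compl_eq_Diff_UNIV card_Diff_subset)
qed

text \<open>The layer of sites that the window gains when it moves one step in direction
  \<open>i\<close>.\<close>

definition slice :: "nat \<Rightarrow> 'd \<Rightarrow> int ^ 'd \<Rightarrow> (int ^ 'd) set" where
  "slice L i x = {c. \<forall>j. c $ j \<in> (if j = i then {x $ i + int L} else {x $ j..<x $ j + int L})}"

lemma finite_slice [simp]: "finite (slice L i x)"
  unfolding slice_def by (rule finite_vec_box) simp

lemma card_slice: "card (slice L i (x :: int ^ 'd)) = L ^ (CARD('d) - 1)"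
proof -
  have "card (slice L i x) = (\<Prod>j\<in>UNIV. if j = i then 1 else L)"
    unfolding slice_def card_vec_box by (intro prod.cong) auto
  also have "\<dots> = L ^ card (- {i})"
    by (simp add: prod.If_cases Compl_eq_Diff_UNIV)
  finally show ?thesis by (simp add: Compl_eq_Diff_UNIV card_Diff_subset)
qed

lemma window_step_subset: "window L (x + axis i 1) \<subseteq> window L x \<union> slice L i x"
proof
  fix c assume "c \<in> window L (x + axis i 1)"
  then have c: "x $ j + axis i 1 $ j \<le> c $ j" "c $ j < x $ j + axis i 1 $ j + int L" for j
    by (simp_all add: window_def)
  have *: "x $ j \<le> c $ j" "j \<noteq> i \<Longrightarrow> c $ j < x $ j + int L" "c $ i \<le> x $ i + int L" for j
    using c[of j] c[of i] by (auto simp: axis_def split: if_splits)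
  show "c \<in> window L x \<union> slice L i x"
  proof (cases "c $ i = x $ i + int L")
    case True
    then show ?thesis using * by (auto simp: slice_def)
  next
    case False
    then have "c $ j < x $ j + int L" for j using * by (cases "j = i") auto
    then show ?thesis using * by (auto simp: window_def)
  qed
qed

lemma slice_component: "c \<in> slice L i x \<Longrightarrow> c $ i = x $ i + int L"
  unfolding slice_def by (drule CollectD, drule spec[of _ i]) simp

lemma slice_other_component: "c \<in> slice L i x \<Longrightarrow> j \<noteq> i \<Longrightarrow> c $ j < x $ j + int L"
  unfolding slice_def by (drule CollectD, drule spec[of _ j]) simp

lemma slice_disjoint_window: "c \<in> slice L i x \<Longrightarrow> c \<notin> window L x"
  by (auto simp: window_def not_less dest!: slice_component intro!: exI[of _ i])

text \<open>On a slice, only the coordinate of its own direction leaves the range of the window. Low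
  labels found in the slices of different directions therefore belong to different sites.\<close>

lemma slice_disjoint: "c \<in> slice L i x \<Longrightarrow> c \<in> slice L j x \<Longrightarrow> i = j"
  using slice_component slice_other_component by (metis less_irrefl)

lemma window_step_mem:
  assumes "c \<in> window L x" "c $ i \<noteq> x $ i"
  shows "c \<in> window L (x + axis i 1)"
proof -
  have c: "x $ j \<le> c $ j" "c $ j < x $ j + int L" for j
    using assms by (simp_all add: window_def)
  have "x $ j + axis i 1 $ j \<le> c $ j \<and> c $ j < x $ j + axis i 1 $ j + int L" for j
    using c[of j] assms(2) by (cases "j = i") (simp_all add: axis_def)
  then show ?thesis by (simp add: window_def)
qed

section \<open>The probability of blocked directions\<close>

text \<open>The sum over r of the bound in \<open>measure_low_labels\<close> without the powers of
  the window size. The exponent d + 1 is the worst case: the minimiser and one low site in the slice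
  of each direction.\<close>

definition tail_const :: "nat \<Rightarrow> real" where
  "tail_const d = (\<Sum>r. (real r + 1) ^ (d + 1) * exp (1 - real r))"

lemma power_le_fact_exp:
  fixes y :: real
  assumes "0 \<le> y" shows "y ^ n \<le> fact n * exp y"
proof -
  have "(\<Sum>m\<in>{n}. y ^ m /\<^sub>R fact m) \<le> (\<Sum>m. y ^ m /\<^sub>R fact m)"
    using assms by (intro sum_le_suminf summable_exp_generic) auto
  then show ?thesis by (simp add: exp_def field_simps)
qed

text \<open>A factor exp((r + 1) / 2) absorbs the power, and a geometric series remains.\<close>

lemma summable_tail: "summable (\<lambda>r. (real r + 1) ^ (d + 1) * exp (1 - real r))"
proof (rule summable_comparison_test')
  let ?C = "2 ^ (d + 1) * fact (d + 1) * exp (3 / 2 :: real)"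
  show "summable (\<lambda>r. ?C * exp (- (1 / 2)) ^ r)"
    by (intro summable_mult summable_geometric) simp
  fix r :: nat
  have "(real r + 1) ^ (d + 1) = 2 ^ (d + 1) * ((real r + 1) / 2) ^ (d + 1)"
    by (simp add: power_divide)
  also have "\<dots> \<le> 2 ^ (d + 1) * (fact (d + 1) * exp ((real r + 1) / 2))"
    by (intro mult_left_mono power_le_fact_exp) auto
  finally have "(real r + 1) ^ (d + 1) * exp (1 - real r) \<le>
      2 ^ (d + 1) * (fact (d + 1) * exp ((real r + 1) / 2)) * exp (1 - real r)"
    by (rule mult_right_mono) simp
  also have "\<dots> = 2 ^ (d + 1) * fact (d + 1) * exp ((real r + 1) / 2 + (1 - real r))"
    by (simp only: exp_add mult.assoc)
  also have "(real r + 1) / 2 + (1 - real r) = 3 / 2 + real r * (- (1 / 2))"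
    by (simp add: field_simps)
  also have "2 ^ (d + 1) * fact (d + 1) * exp \<dots> = ?C * exp (- (1 / 2)) ^ r"
    by (simp only: exp_add exp_of_nat_mult mult.assoc)
  finally show "norm ((real r + 1) ^ (d + 1) * exp (1 - real r)) \<le> ?C * exp (- (1 / 2)) ^ r"
    by simp
qed

lemma tail_const_ge:
  assumes "finite R" "q \<le> d"
  shows "(\<Sum>r\<in>R. (real r + 1) ^ (q + 1) * exp (1 - real r)) \<le> tail_const d"
proof -
  have "(\<Sum>r\<in>R. (real r + 1) ^ (q + 1) * exp (1 - real r)) \<le>
        (\<Sum>r\<in>R. (real r + 1) ^ (d + 1) * exp (1 - real r))"
    using assms by (intro sum_mono mult_right_mono power_increasing) auto
  also have "\<dots> \<le> tail_const d"
    unfolding tail_const_def by (intro sum_le_suminf summable_tail assms) auto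
  finally show ?thesis .
qed

lemma tail_const_ge_1: "1 \<le> tail_const d"
proof -
  have "(1::real) \<le> exp 1" by simp
  also have "\<dots> \<le> tail_const d" using tail_const_ge[of "{0}" d d] by simp
  finally show ?thesis .
qed

text \<open>The event that, up to the resolution \<open>1 / N\<close>, the label of \<open>m\<close> is minimal in the window
  and equal to \<open>r / N\<close>, while the labels of the sites in \<open>V\<close> are not larger.\<close>

definition low_labels :: "nat \<Rightarrow> (int ^ 'd) set \<Rightarrow> int ^ 'd \<Rightarrow> (int ^ 'd) set \<Rightarrow> nat
    \<Rightarrow> (nat \<times> (int ^ 'd) \<Rightarrow> real) set" where
  "low_labels k W m V r =
     {\<omega>. \<forall>p\<in>Pair k ` (insert m V \<union> (W - {m})).
        \<omega> p \<in> (if p \<in> Pair k ` (W - {m}) then {real r / real (card W)..}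
               else {..(real r + 1) / real (card W)})}"

lemma sets_low_labels [measurable]:
  "finite W \<Longrightarrow> finite V \<Longrightarrow> low_labels k W m V r \<in> sets noise"
  unfolding low_labels_def by (intro sets_noise_cylinder) auto

text \<open>Let N = \<open>card W\<close>. By independence, the labels of \<open>m\<close> and of
  \<open>V\<close> contribute at most (r + 1) / N each, and the N - 1 other labels of the window
  contribute (1 - r / N)^(N - 1) \<le> exp(-r + r / N), where r / N \<le> 1.\<close>

lemma measure_low_labels:
  assumes W: "finite W" "m \<in> W" and V: "finite V" "V \<inter> W = {}" and r: "r \<le> card W"
  shows "measure noise (low_labels k W m V r) \<le>
           ((real r + 1) / real (card W)) ^ (card V + 1) * exp (1 - real r)"
proof -
  let ?U = "uniform_measure lborel {0..1::real}"
  let ?E = "\<lambda>p. if p \<in> Pair k ` (W - {m}) then {real r / real (card W)..}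
               else {..(real r + 1) / real (card W)}"
  define N where "N = card W"
  have N0: "0 < N" using W by (auto simp: N_def card_gt_0_iff)
  have "measure noise (low_labels k W m V r) = (\<Prod>p\<in>Pair k ` (insert m V \<union> (W - {m})). measure ?U (?E p))"
    unfolding low_labels_def using W V by (intro measure_noise_cylinder) auto
  also have "\<dots> = (\<Prod>p\<in>Pair k ` insert m V. measure ?U (?E p)) * (\<Prod>p\<in>Pair k ` (W - {m}). measure ?U (?E p))"
    unfolding image_Un using W V by (intro prod.union_disjoint) auto
  also have "\<dots> \<le> ((real r + 1) / N) ^ (card V + 1) * exp (1 - real r)"
  proof (rule mult_mono)
    have "(\<Prod>p\<in>Pair k ` insert m V. measure ?U (?E p)) \<le> (\<Prod>p\<in>Pair k ` insert m V. (real r + 1) / N)"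
      using W V by (intro prod_mono) (auto simp: N_def intro!: measure_uniform_atMost)
    also have "card (Pair k ` insert m V) = card V + 1"
      using W V by (subst card_image) (auto simp: inj_on_def card_insert_if)
    then have "(\<Prod>p\<in>Pair k ` insert m V. (real r + 1) / N) = ((real r + 1) / N) ^ (card V + 1)"
      by simp
    finally show "(\<Prod>p\<in>Pair k ` insert m V. measure ?U (?E p)) \<le> ((real r + 1) / N) ^ (card V + 1)" .
    have "(\<Prod>p\<in>Pair k ` (W - {m}). measure ?U (?E p)) = (\<Prod>p\<in>Pair k ` (W - {m}). 1 - real r / N)"
      using r N0 by (intro prod.cong) (auto simp: N_def measure_uniform_atLeast)
    also have "\<dots> = (1 - real r / N) ^ (N - 1)"
      using W by (simp add: card_image inj_on_def N_def)
    also have "\<dots> \<le> exp (- real r / N) ^ (N - 1)"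
      using r N0 exp_ge_add_one_self[of "- real r / N"] by (intro power_mono) (auto simp: N_def)
    also have "\<dots> = exp (- real r + real r / N)"
      using N0 by (simp add: exp_of_nat_mult[symmetric] of_nat_diff field_simps)
    also have "\<dots> \<le> exp (1 - real r)"
      using r N0 by (simp add: N_def)
    finally show "(\<Prod>p\<in>Pair k ` (W - {m}). measure ?U (?E p)) \<le> exp (1 - real r)" .
  qed (auto intro!: prod_nonneg)
  finally show ?thesis by (simp add: N_def)
qed

text \<open>Let \<open>m\<close> minimise the labels in the window. If direction \<open>i\<close> is blocked, then either \<open>m\<close> lies on
  the face that is lost by stepping in direction \<open>i\<close>, or the slice gained by that step contains a
  smaller label. Each alternative has probability of order \<open>1 / 2 ^ k\<close>, and the alternatives for
  different directions are essentially independent.\<close>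

lemma blocked_low_labels:
  fixes x :: "int ^ 'd"
  assumes inj: "inj \<omega>" and unit: "\<And>p. \<omega> p \<in> {0..1}"
    and blocked: "\<And>i. i \<in> I \<Longrightarrow> blocked \<omega> k i x"
  shows "\<exists>J\<in>Pow I. \<exists>m\<in>{m \<in> window (2 ^ k) x. \<forall>i\<in>J. m $ i = x $ i}.
           \<exists>v\<in>PiE (I - J) (\<lambda>i. slice (2 ^ k) i x). \<exists>r\<in>{..card (window (2 ^ k) x)}.
             \<omega> \<in> low_labels k (window (2 ^ k) x) m (v ` (I - J)) r"
proof -
  let ?W = "window (2 ^ k) x"
  define N where "N = card ?W"
  have N: "N \<noteq> 0" by (simp add: N_def card_window)
  then have "?W \<noteq> {}" by (auto simp: N_def)
  from arg_min_if_finite[OF finite_window this, of "\<lambda>c. \<omega> (k, c)"]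
  obtain m where m: "m \<in> ?W" and "\<And>c. c \<in> ?W \<Longrightarrow> \<omega> (k, m) \<le> \<omega> (k, c)"
    by (auto simp: not_less)
  \<comment> \<open>Distinct labels make the minimum strict, so another site whose label is not
    larger than that of \<open>m\<close> lies outside the window.\<close>
  then have min: "\<omega> (k, m) < \<omega> (k, c)" if "c \<in> ?W - {m}" for c
    using that inj by (metis DiffE injD insertI1 order_less_le prod.inject)
  \<comment> \<open>The directions whose step removes \<open>m\<close> from the window. Every other
    blocked direction must be explained by a low label in its slice.\<close>
  define J where "J = {i \<in> I. m $ i = x $ i}"
  have "\<exists>c\<in>slice (2 ^ k) i x. \<omega> (k, c) \<le> \<omega> (k, m)" if i: "i \<in> I - J" for i
  proof -
    let ?W' = "window (2 ^ k) (x + axis i 1)"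
    have "m \<in> ?W \<inter> ?W'"
      using i m by (auto simp: J_def intro: window_step_mem)
    then have "\<not> leader (\<lambda>c. \<omega> (k, c)) (?W \<union> ?W') m"
      using blocked[of i] i unfolding blocked_def by blast
    then obtain c where c: "c \<in> ?W \<union> ?W'" "c \<noteq> m" "\<omega> (k, c) \<le> \<omega> (k, m)"
      using m unfolding leader_def by (auto simp: not_less)
    moreover have "c \<notin> ?W" using min[of c] c by auto
    ultimately show ?thesis using window_step_subset by blast
  qed
  then obtain v where v: "\<And>i. i \<in> I - J \<Longrightarrow> v i \<in> slice (2 ^ k) i x \<and> \<omega> (k, v i) \<le> \<omega> (k, m)"
    by metis
  define v' where "v' = restrict v (I - J)"
  define r where "r = nat \<lfloor>real N * \<omega> (k, m)\<rfloor>"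
  have r: "real r \<le> N * \<omega> (k, m)" "N * \<omega> (k, m) < real r + 1"
    using unit[of "(k, m)"] by (auto simp: r_def)
  have "N * \<omega> (k, m) \<le> N" using unit[of "(k, m)"] by (simp add: mult_left_le)
  then have "r \<le> N" using r by linarith
  moreover have lo: "real r / N \<le> \<omega> (k, m)" and hi: "\<omega> (k, m) \<le> (real r + 1) / N"
    using r N by (auto simp: field_simps)
  have "\<omega> \<in> low_labels k ?W m (v' ` (I - J)) r"
    unfolding low_labels_def N_def[symmetric]
  proof (intro CollectI ballI)
    fix p assume p: "p \<in> Pair k ` (insert m (v' ` (I - J)) \<union> (?W - {m}))"
    show "\<omega> p \<in> (if p \<in> Pair k ` (?W - {m}) then {real r / N..} else {..(real r + 1) / N})"
    proof (cases "p \<in> Pair k ` (?W - {m})")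
      case True
      then obtain c where c: "p = (k, c)" "c \<in> ?W - {m}" by blast
      then have "real r / N \<le> \<omega> p" using min[OF c(2)] lo by simp
      then show ?thesis using True by simp
    next
      case False
      then have "p \<in> Pair k ` insert m (v' ` (I - J))" using p by blast
      then have "\<omega> p \<le> \<omega> (k, m)" using v by (auto simp: v'_def)
      then show ?thesis using False hi by simp
    qed
  qed
  moreover have "v' \<in> PiE (I - J) (\<lambda>i. slice (2 ^ k) i x)" using v by (auto simp: v'_def)
  moreover have "J \<in> Pow I" "m \<in> {m \<in> ?W. \<forall>i\<in>J. m $ i = x $ i}" using m by (auto simp: J_def)
  ultimately show ?thesis unfolding N_def by blast
qed

text \<open>The factor 2^d bounds the number of subsets \<open>J\<close> in the union bound of
  \<open>measure_blocked\<close>.\<close>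

definition block_const :: "nat \<Rightarrow> real" where
  "block_const d = 2 ^ d * tail_const d"

lemma block_const_ge_1: "1 \<le> block_const d"
  using tail_const_ge_1[of d] mult_mono[of 1 "2 ^ d" 1 "tail_const d"] by (simp add: block_const_def)

lemma measurable_blocked [measurable]: "Measurable.pred noise (\<lambda>\<omega>. blocked \<omega> k i x)"
  unfolding blocked_def leader_def by (measurable; simp)

text \<open>Union bound over the witnesses of \<open>blocked_low_labels\<close>. With L = 2^k, N =
  L^d and q = |I - J|, there are at most L^(d - |J|) choices of \<open>m\<close> and L^((d - 1) q)
  choices of \<open>v\<close>, and the sum over \<open>r\<close> is of order N^(-(q + 1)). Since |I|
  = |J| + q, the product is of order L^(-|I|) for every \<open>J\<close>.\<close>

lemma measure_blocked:
  fixes x :: "int ^ 'd"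
  shows "measure noise {\<omega>. \<forall>i\<in>I. blocked \<omega> k i x} \<le>
           block_const CARD('d) * (1 / 2 ^ k) ^ card I"
proof -
  let ?d = "CARD('d)" and ?W = "window (2 ^ k) x"
  define L :: nat where "L = 2 ^ k"
  define N where "N = card ?W"
  have L0: "0 < L" and N: "N = L ^ ?d" by (simp_all add: L_def N_def card_window)
  define M where "M J = {m \<in> ?W. \<forall>i\<in>J. m $ i = x $ i}" for J
  define VV where "VV J = PiE (I - J) (\<lambda>i. slice (2 ^ k) i x)" for J
  have fin: "finite (M J)" "finite (VV J)" for J by (auto simp: M_def VV_def intro!: finite_PiE)
  let ?G = "\<lambda>J m v r. low_labels k ?W m (v ` (I - J)) r"
  have meas: "?G J m v r \<in> sets noise" for J m v r by (intro sets_low_labels) auto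
  have "AE \<omega> in (noise :: (nat \<times> (int ^ 'd) \<Rightarrow> real) measure). \<forall>p. \<omega> p \<in> {0..1}"
    unfolding AE_all_countable by (intro allI AE_noise_unit)
  with AE_noise_inj have "AE \<omega> in noise. \<omega> \<in> {\<omega>. \<forall>i\<in>I. blocked \<omega> k i x} \<longrightarrow>
      \<omega> \<in> (\<Union>J\<in>Pow I. \<Union>m\<in>M J. \<Union>v\<in>VV J. \<Union>r\<in>{..N}. ?G J m v r)"
  proof eventually_elim
    case (elim \<omega>)
    show ?case
    proof
      assume "\<omega> \<in> {\<omega>. \<forall>i\<in>I. blocked \<omega> k i x}"
      then show "\<omega> \<in> (\<Union>J\<in>Pow I. \<Union>m\<in>M J. \<Union>v\<in>VV J. \<Union>r\<in>{..N}. ?G J m v r)"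
        using blocked_low_labels[of \<omega> I k x] elim
        unfolding M_def VV_def N_def UN_iff by blast
    qed
  qed
  then have "measure noise {\<omega>. \<forall>i\<in>I. blocked \<omega> k i x} \<le>
      measure noise (\<Union>J\<in>Pow I. \<Union>m\<in>M J. \<Union>v\<in>VV J. \<Union>r\<in>{..N}. ?G J m v r)"
    by (rule noise.finite_measure_mono_AE) (intro sets.finite_UN meas fin finite_Pow_iff[THEN iffD2] finite; simp)
  also have "\<dots> \<le> (\<Sum>J\<in>Pow I. \<Sum>m\<in>M J. \<Sum>v\<in>VV J. \<Sum>r\<in>{..N}. measure noise (?G J m v r))"
    by (intro order_trans[OF measure_UNION_le] sum_mono sets.finite_UN meas fin finite_Pow_iff[THEN iffD2] finite finite_atMost)
      (rule order_refl)
  also have "\<dots> \<le> (\<Sum>J\<in>Pow I. tail_const ?d * (1 / L) ^ card I)"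
  proof (intro sum_mono)
    fix J assume J: "J \<in> Pow I"
    define q where "q = card (I - J)"
    have "q \<le> ?d" "card J \<le> ?d"
      unfolding q_def by (intro card_mono; simp)+
    moreover have "card I = card J + q"
      unfolding q_def using J by (subst card_Diff_subset) (auto simp: card_mono)
    ultimately have q: "q \<le> ?d" "card J \<le> ?d" "card I = card J + q" by auto
    have "(\<Sum>m\<in>M J. \<Sum>v\<in>VV J. \<Sum>r\<in>{..N}. measure noise (?G J m v r)) \<le>
          (\<Sum>m\<in>M J. \<Sum>v\<in>VV J. tail_const ?d / real N ^ (q + 1))"
    proof (intro sum_mono)
      fix m v assume m: "m \<in> M J" and v: "v \<in> VV J"
      \<comment> \<open>Disjoint slices make the q low sites distinct, so none of the q + 1 factors
        is lost.\<close>
      have "inj_on v (I - J)"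
        using v by (intro inj_onI) (metis PiE_mem VV_def slice_disjoint)
      then have card: "card (v ` (I - J)) = q" by (simp add: card_image q_def)
      have "v ` (I - J) \<inter> ?W = {}"
        using v slice_disjoint_window by (fastforce simp: VV_def)
      then have "(\<Sum>r\<in>{..N}. measure noise (?G J m v r)) \<le>
            (\<Sum>r\<in>{..N}. ((real r + 1) / N) ^ (q + 1) * exp (1 - real r))"
        using m unfolding card[symmetric] N_def
        by (intro sum_mono measure_low_labels) (auto simp: M_def)
      also have "\<dots> = (\<Sum>r\<in>{..N}. (real r + 1) ^ (q + 1) * exp (1 - real r)) / real N ^ (q + 1)"
        by (simp add: sum_divide_distrib power_divide)
      also have "\<dots> \<le> tail_const ?d / real N ^ (q + 1)"
        by (intro divide_right_mono tail_const_ge q) auto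
      finally show "(\<Sum>r\<in>{..N}. measure noise (?G J m v r)) \<le> tail_const ?d / real N ^ (q + 1)" .
    qed
    also have "\<dots> = real (card (M J) * card (VV J)) * (tail_const ?d / real N ^ (q + 1))"
      by simp
    also have "card (VV J) = L ^ ((?d - 1) * q)"
      by (simp add: VV_def card_PiE card_slice L_def q_def power_mult)
    also have "real (card (M J) * L ^ ((?d - 1) * q)) * (tail_const ?d / real N ^ (q + 1)) \<le>
        real (L ^ (?d - card J) * L ^ ((?d - 1) * q)) * (tail_const ?d / real N ^ (q + 1))"
      using card_window_face[of "2 ^ k" x J] tail_const_ge_1[of ?d]
      by (intro mult_right_mono of_nat_mono mult_right_mono[where 'a = nat]) (auto simp: M_def L_def)
    also have "\<dots> = tail_const ?d * (1 / L) ^ card I"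
    proof -
      have "L ^ (?d - card J) * L ^ ((?d - 1) * q) * L ^ card I = N ^ (q + 1)"
      proof -
        have "(?d - card J) + (?d - 1) * q + card I = ?d * (q + 1)"
          using q by (cases ?d) (auto simp: algebra_simps)
        then show ?thesis unfolding N by (metis power_add power_mult)
      qed
      then have "real (L ^ (?d - card J) * L ^ ((?d - 1) * q)) * real L ^ card I = real N ^ (q + 1)"
        by (metis of_nat_mult of_nat_power)
      then have "real (L ^ (?d - card J) * L ^ ((?d - 1) * q)) / real N ^ (q + 1) = 1 / real L ^ card I"
        using L0 N by (simp add: field_simps)
      then have "tail_const ?d * (real (L ^ (?d - card J) * L ^ ((?d - 1) * q)) / real N ^ (q + 1)) =
          tail_const ?d * (1 / real L ^ card I)"
        by (rule arg_cong)
      then show ?thesis by (simp only: power_one_over times_divide_eq_right times_divide_eq_left mult.commute)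
    qed
    finally show "(\<Sum>m\<in>M J. \<Sum>v\<in>VV J. \<Sum>r\<in>{..N}. measure noise (?G J m v r)) \<le>
        tail_const ?d * (1 / L) ^ card I" .
  qed
  also have "\<dots> = 2 ^ card I * tail_const ?d * (1 / L) ^ card I"
    by (simp add: card_Pow)
  also have "\<dots> \<le> 2 ^ ?d * tail_const ?d * (1 / L) ^ card I"
    using tail_const_ge_1[of ?d] by (intro mult_right_mono power_increasing card_mono) auto
  finally show ?thesis by (simp add: block_const_def L_def)
qed

section \<open>Trapped sites\<close>

lemma translate_measurable [measurable]: "translate s \<in> measurable noise noise"
  unfolding noise_def by (rule measurable_PiM_single') (auto simp: translate_def split: prod.splits)

lemma distr_translate: "distr noise noise (translate s) = (noise :: (nat \<times> (int ^ 'd) \<Rightarrow> real) measure)"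
proof -
  define f where "f = (\<lambda>(k :: nat, c :: int ^ 'd). (k, c + s))"
  have "inj f" by (auto simp: f_def inj_def)
  then have "distr noise noise (\<lambda>\<omega>. \<lambda>p\<in>UNIV. \<omega> (f p)) = noise"
    unfolding noise_def
    using distr_PiM_reindex[of UNIV "\<lambda>_. uniform_measure lborel {0..1}" f UNIV] prob_space_uniform
    by simp
  also have "(\<lambda>\<omega>. \<lambda>p\<in>UNIV. \<omega> (f p)) = translate s"
    by (auto simp: f_def translate_def fun_eq_iff)
  finally show ?thesis .
qed

lemma measure_translate:
  assumes "A \<in> sets noise" shows "measure noise (translate s -` A) = measure noise A"
  using measure_distr[OF translate_measurable assms, of s] by (simp add: distr_translate)

lemma indep_noise: "noise.indep_vars (\<lambda>_. uniform_measure lborel {0..1}) (\<lambda>p \<omega>. \<omega> p) UNIV"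
  unfolding noise_def
  by (subst noise.indep_vars_iff_distr_eq_PiM[unfolded noise_def])
     (auto simp: noise_product.PiM_component restrict_UNIV distr_id)

text \<open>Stated for a general \<open>f\<close> and in terms of the labels in the two windows, so
  that it also applies to configurations restricted to part of the index set.\<close>

lemma pred_blocked:
  assumes "\<And>c. c \<in> window (2 ^ k) x \<union> window (2 ^ k) (x + axis i 1) \<Longrightarrow>
             (\<lambda>\<omega>. f \<omega> (k, c)) \<in> borel_measurable M"
  shows "Measurable.pred M (\<lambda>\<omega>. blocked (f \<omega>) k i x)"
proof -
  let ?S = "window (2 ^ k) x \<union> window (2 ^ k) (x + axis i 1)"
  have "Measurable.pred M (\<lambda>\<omega>. f \<omega> (k, c) < f \<omega> (k, c'))" if "c \<in> ?S" "c' \<in> ?S" for c c'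
    using assms[OF that(1)] assms[OF that(2)] by measurable
  then have "Measurable.pred M (\<lambda>\<omega>. leader (\<lambda>c. f \<omega> (k, c)) ?S c)" if "c \<in> ?S" for c
    using that unfolding leader_def by (intro pred_intros_logic pred_intros_finite) auto
  then show ?thesis
    unfolding blocked_def by (intro pred_intros_logic pred_intros_finite) auto
qed

lemma sets_blocked [measurable]: "{\<omega>. blocked \<omega> k i x} \<in> sets noise"
  using measurable_blocked[of k i x] by (simp add: pred_def)

lemma blocked_cong:
  assumes "\<And>c. c \<in> window (2 ^ k) x \<union> window (2 ^ k) (x + axis i 1) \<Longrightarrow> \<omega> (k, c) = \<omega>' (k, c)"
  shows "blocked \<omega> k i x \<longleftrightarrow> blocked \<omega>' k i x"
  using assms unfolding blocked_def leader_def by (intro arg_cong[where f=Not] bex_cong refl conj_cong ball_cong) auto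

text \<open>Union bound over directions and scales, the latter a geometric series. It controls both
  the cutoff in \<open>measure_trapped\<close> and the truncation error of
  \<open>parent_upto\<close>.\<close>

lemma measure_blocked_tail:
  fixes x :: "int ^ 'd"
  shows "measure noise {\<omega>. \<exists>j>K. \<exists>i. blocked \<omega> j i x} \<le>
           real CARD('d) * block_const CARD('d) * (1 / 2) ^ K"
proof -
  let ?C = "real CARD('d) * block_const CARD('d)"
  define A where "A n = {\<omega>. \<exists>i. blocked \<omega> (K + 1 + n) i x}" for n
  have A_eq: "A n = (\<Union>i\<in>UNIV. {\<omega> \<in> space noise. blocked \<omega> (K + 1 + n) i x})" for n
    by (auto simp: A_def)
  have meas: "A n \<in> sets noise" for n
    unfolding A_eq by (intro sets.finite_UN) (auto intro: sets_blocked[simplified])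
  have le: "measure noise (A n) \<le> ?C * (1 / 2) ^ K * (1 / 2) ^ (n + 1)" for n
  proof -
    have "measure noise (A n) \<le> (\<Sum>i\<in>UNIV. measure noise {\<omega> \<in> space noise. blocked \<omega> (K + 1 + n) i x})"
      unfolding A_eq by (intro measure_UNION_le) auto
    also have "\<dots> \<le> (\<Sum>i\<in>(UNIV :: 'd set). block_const CARD('d) * (1 / 2) ^ (K + 1 + n))"
    proof (intro sum_mono)
      fix i :: 'd
      show "measure noise {\<omega> \<in> space noise. blocked \<omega> (K + 1 + n) i x} \<le>
          block_const CARD('d) * (1 / 2) ^ (K + 1 + n)"
        using measure_blocked[of "{i}" "K + 1 + n" x] by (simp add: power_one_over)
    qed
    finally show ?thesis by (simp add: power_add mult_ac)
  qed
  have sums: "(\<lambda>n. (1 / 2 :: real) ^ (n + 1)) sums 1"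
    using power_half_series by simp
  then have sums': "(\<lambda>n. ?C * (1 / 2) ^ K * (1 / 2) ^ (n + 1)) sums (?C * (1 / 2) ^ K)"
    using sums_mult by fastforce
  then have summable: "summable (\<lambda>n. measure noise (A n))"
    using le by (intro summable_comparison_test'[OF sums_summable]) auto
  have "{\<omega>. \<exists>j>K. \<exists>i. blocked \<omega> j i x} = (\<Union>n. A n)"
  proof -
    have "K < j \<longleftrightarrow> (\<exists>n. j = K + 1 + n)" for j by presburger
    then show ?thesis by (auto simp: A_def)
  qed
  then have "measure noise {\<omega>. \<exists>j>K. \<exists>i. blocked \<omega> j i x} \<le> (\<Sum>n. measure noise (A n))"
    using summable meas by (simp add: noise.finite_measure_subadditive_countably image_subset_iff)
  also have "\<dots> \<le> ?C * (1 / 2) ^ K"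
    using sums_le[OF le summable_sums[OF summable] sums'] .
  finally show ?thesis .
qed

text \<open>Directions that share a scale are handled together by \<open>measure_blocked\<close>.
  Different scales use disjoint sets of labels, so these groups are independent.\<close>

lemma measure_blocked_scales:
  fixes x :: "int ^ 'd" and \<phi> :: "'d \<Rightarrow> nat"
  shows "measure noise {\<omega>. \<forall>i. blocked \<omega> (\<phi> i) i x} \<le>
           (\<Prod>i\<in>UNIV. block_const CARD('d) * (1 / 2) ^ \<phi> i)"
proof -
  let ?C = "block_const CARD('d)"
  let ?U = "\<lambda>_ :: nat \<times> (int ^ 'd). uniform_measure lborel {0..1::real}"
  define S where "S j = {j} \<times> (UNIV :: (int ^ 'd) set)" for j :: nat
  define D where "D j = {i. \<phi> i = j}" for j
  define E where "E j = {u \<in> space (PiM (S j) ?U). \<forall>i\<in>D j. blocked u j i x}" for j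
  have "(\<lambda>u. u (j, c)) \<in> borel_measurable (PiM (S j) ?U)" for j c
    using measurable_component_singleton[of "(j, c)" "S j" ?U]
    by (simp add: S_def cong: measurable_cong_sets)
  then have E: "E j \<in> sets (PiM (S j) ?U)" for j
    unfolding E_def by (intro predE pred_intros_finite pred_blocked finite)
  have restr: "restrict \<omega> (S j) \<in> E j \<longleftrightarrow> (\<forall>i\<in>D j. blocked \<omega> j i x)" for \<omega> j
    using blocked_cong[of j x _ "restrict \<omega> (S j)" \<omega>]
    by (auto simp: E_def S_def space_PiM)
  have "noise.indep_vars (\<lambda>j. PiM (S j) ?U) (\<lambda>j \<omega>. restrict (\<lambda>p. \<omega> p) (S j)) (range \<phi>)"
    by (rule noise.indep_vars_restrict[OF indep_noise]) (auto simp: S_def disjoint_family_on_def)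
  from noise.indep_varsD_finite[OF this _ _ E]
  have "measure noise (\<Inter>j\<in>range \<phi>. {\<omega>. \<forall>i\<in>D j. blocked \<omega> j i x}) =
      (\<Prod>j\<in>range \<phi>. measure noise {\<omega>. \<forall>i\<in>D j. blocked \<omega> j i x})"
    by (simp add: vimage_def restr)
  also have "(\<Inter>j\<in>range \<phi>. {\<omega>. \<forall>i\<in>D j. blocked \<omega> j i x}) = {\<omega>. \<forall>i. blocked \<omega> (\<phi> i) i x}"
    by (auto simp: D_def) metis
  also have "(\<Prod>j\<in>range \<phi>. measure noise {\<omega>. \<forall>i\<in>D j. blocked \<omega> j i x}) \<le>
      (\<Prod>j\<in>range \<phi>. \<Prod>i\<in>D j. ?C * (1 / 2) ^ \<phi> i)"
  proof (intro prod_mono conjI measure_nonneg)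
    fix j assume "j \<in> range \<phi>"
    \<comment> \<open>A nonempty group and a constant of at least 1 allow one factor
      \<open>?C\<close> per direction instead of one per scale, so the product can run over the
      directions.\<close>
    then have "1 \<le> card (D j)" by (auto simp: D_def card_gt_0_iff Suc_le_eq)
    then have "?C ^ 1 \<le> ?C ^ card (D j)" by (intro power_increasing block_const_ge_1)
    then have "?C * (1 / 2 ^ j) ^ card (D j) \<le> ?C ^ card (D j) * (1 / 2 ^ j) ^ card (D j)"
      by (intro mult_right_mono) auto
    also have "\<dots> = (\<Prod>i\<in>D j. ?C * (1 / 2) ^ j)"
      by (simp add: power_one_over power_divide)
    also have "\<dots> = (\<Prod>i\<in>D j. ?C * (1 / 2) ^ \<phi> i)"
      by (intro prod.cong) (auto simp: D_def)
    finally show "measure noise {\<omega>. \<forall>i\<in>D j. blocked \<omega> j i x} \<le> (\<Prod>i\<in>D j. ?C * (1 / 2) ^ \<phi> i)"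
      using measure_blocked[of "D j" j x] by linarith
  qed
  also have "\<dots> = (\<Prod>i\<in>UNIV. ?C * (1 / 2) ^ \<phi> i)"
    unfolding D_def using prod.image_gen[of UNIV "\<lambda>i. ?C * (1 / 2) ^ \<phi> i" \<phi>] by simp
  finally show ?thesis .
qed

lemma measurable_trapped [measurable]: "Measurable.pred noise (\<lambda>\<omega>. trapped \<omega> k x)"
  unfolding trapped_def by measurable

lemma half_sum_shift: "(\<Sum>j\<in>{k..<k + m}. (1 / 2 :: real) ^ j) = (1 / 2) ^ k * (\<Sum>j<m. (1 / 2) ^ j)"
  by (induction m) (auto simp: power_add algebra_simps)

definition trap_const :: "nat \<Rightarrow> real" where
  "trap_const d = (2 * block_const d) ^ d"

text \<open>At a trapped site every direction has a blocking scale. Summing over all assignments of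
  scales and exchanging sum and product gives the d-th power of a geometric sum of order 2^(-k).
  Scales above k + n are cut off to keep the union finite, and then n tends to infinity.\<close>

lemma measure_trapped:
  fixes x :: "int ^ 'd"
  shows "measure noise {\<omega>. trapped \<omega> k x} \<le> trap_const CARD('d) / (2 ^ k) ^ CARD('d)"
proof -
  let ?C = "block_const CARD('d)"
  let ?B = "trap_const CARD('d) / (2 ^ k) ^ CARD('d)"
  have C: "0 < ?C" using block_const_ge_1[of "CARD('d)"] by linarith
  have "measure noise {\<omega>. trapped \<omega> k x} \<le> ?B + real CARD('d) * ?C * (1 / 2) ^ n" for n
  proof -
    let ?\<Phi> = "PiE (UNIV :: 'd set) (\<lambda>_. {k..<k + n + 1})"
    let ?A = "\<lambda>\<phi>. {\<omega> \<in> space noise. \<forall>i. blocked \<omega> (\<phi> i) i x}"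
    let ?T = "{\<omega> \<in> space noise. \<exists>j>k + n. \<exists>i. blocked \<omega> j i x}"
    have fin: "finite ?\<Phi>" by (intro finite_PiE) auto
    have A: "?A \<phi> \<in> sets noise" for \<phi> by measurable
    have T: "?T \<in> sets noise" by measurable
    have "{\<omega>. trapped \<omega> k x} \<subseteq> (\<Union>\<phi>\<in>?\<Phi>. ?A \<phi>) \<union> ?T"
    proof
      fix \<omega> assume "\<omega> \<in> {\<omega>. trapped \<omega> k x}"
      then obtain \<phi> where \<phi>: "\<And>i. k \<le> \<phi> i" "\<And>i. blocked \<omega> (\<phi> i) i x"
        unfolding trapped_def mem_Collect_eq by metis
      show "\<omega> \<in> (\<Union>\<phi>\<in>?\<Phi>. ?A \<phi>) \<union> ?T"
      proof (cases "\<forall>i. \<phi> i \<le> k + n")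
        case True
        then have "\<phi> \<in> ?\<Phi>" using \<phi> by (auto simp: less_Suc_eq_le)
        then show ?thesis using \<phi> by auto
      next
        case False
        then have "\<omega> \<in> ?T" using \<phi> by (auto simp: not_le)
        then show ?thesis by blast
      qed
    qed
    then have "measure noise {\<omega>. trapped \<omega> k x} \<le> measure noise ((\<Union>\<phi>\<in>?\<Phi>. ?A \<phi>) \<union> ?T)"
      by (intro noise.finite_measure_mono sets.Un sets.finite_UN fin A T)
    also have "\<dots> \<le> measure noise (\<Union>\<phi>\<in>?\<Phi>. ?A \<phi>) + measure noise ?T"
      by (intro measure_Un_le sets.finite_UN fin A T)
    also have "measure noise (\<Union>\<phi>\<in>?\<Phi>. ?A \<phi>) \<le> (\<Sum>\<phi>\<in>?\<Phi>. measure noise (?A \<phi>))"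
      by (intro measure_UNION_le fin A)
    also have "\<dots> \<le> (\<Sum>\<phi>\<in>?\<Phi>. \<Prod>i\<in>UNIV. ?C * (1 / 2) ^ \<phi> i)"
      using measure_blocked_scales by (intro sum_mono) simp
    also have "\<dots> = (\<Prod>i\<in>(UNIV :: 'd set). \<Sum>j\<in>{k..<k + n + 1}. ?C * (1 / 2) ^ j)"
      by (rule prod_sum_PiE[symmetric]) auto
    also have "\<dots> = (?C * (\<Sum>j\<in>{k..<k + n + 1}. (1 / 2) ^ j)) ^ CARD('d)"
      by (simp add: sum_distrib_left del: sum.op_ivl_Suc)
    also have "(\<Sum>j\<in>{k..<k + n + 1}. (1 / 2 :: real) ^ j) = (1 / 2) ^ k * (\<Sum>j<n + 1. (1 / 2) ^ j)"
      by (simp only: half_sum_shift add.assoc)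
    also have "(\<Sum>j<n + 1. (1 / 2 :: real) ^ j) = 2 - 2 * (1 / 2) ^ (n + 1)"
      by (subst sum_gp_strict) (simp add: field_simps)
    also have "(?C * ((1 / 2) ^ k * (2 - 2 * (1 / 2) ^ (n + 1)))) ^ CARD('d) \<le> (?C * ((1 / 2) ^ k * 2)) ^ CARD('d)"
      using C power_le_one[of "1 / 2 :: real" "n + 1"]
      by (intro power_mono mult_left_mono mult_nonneg_nonneg) (simp_all del: power_Suc add: less_imp_le)
    also have "\<dots> = ?B"
      by (simp add: trap_const_def power_mult_distrib power_one_over field_simps)
    also have "measure noise ?T \<le> real CARD('d) * ?C * (1 / 2) ^ (k + n)"
      using measure_blocked_tail[of "k + n" x] by simp
    also have "\<dots> \<le> real CARD('d) * ?C * (1 / 2) ^ n"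
      using C by (intro mult_left_mono power_decreasing) auto
    finally show ?thesis by simp
  qed
  moreover have "(\<lambda>n. ?B + real CARD('d) * ?C * (1 / 2) ^ n) \<longlonglongrightarrow> ?B + real CARD('d) * ?C * 0"
    by (intro tendsto_intros LIMSEQ_power_zero) auto
  ultimately have "measure noise {\<omega>. trapped \<omega> k x} \<le> ?B + real CARD('d) * ?C * 0"
    by (meson LIMSEQ_le_const)
  then show ?thesis by simp
qed

section \<open>The decay of the height\<close>

text \<open>The least scale is a natural number, and the direction is a function of the set of free
  directions, which takes finitely many values. Both can thus be composed through discrete
  spaces.\<close>

lemma measurable_escape:
  fixes B :: "'w \<Rightarrow> nat \<Rightarrow> 'd::finite \<Rightarrow> bool"
  assumes [measurable]: "\<And>j i. Measurable.pred M (\<lambda>\<omega>. B \<omega> j i)"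
  shows "(\<lambda>\<omega>. escape (B \<omega>)) \<in> measurable M (count_space UNIV)"
proof -
  define U where "U k \<omega> = {i. \<forall>j\<ge>k. \<not> B \<omega> j i}" for k \<omega>
  define K where "K \<omega> = (LEAST k. \<exists>i. \<forall>j\<ge>k. \<not> B \<omega> j i)" for \<omega>
  have K: "K \<in> measurable M (count_space UNIV)"
    unfolding K_def[abs_def] by measurable
  have U: "U k \<in> measurable M (count_space UNIV)" for k
  proof (subst measurable_count_space_eq2_countable; safe?)
    fix S :: "'d set"
    have "{\<omega> \<in> space M. \<forall>i. i \<in> S \<longleftrightarrow> (\<forall>j\<ge>k. \<not> B \<omega> j i)} \<in> sets M"
      by measurable
    also have "{\<omega> \<in> space M. \<forall>i. i \<in> S \<longleftrightarrow> (\<forall>j\<ge>k. \<not> B \<omega> j i)} = U k -` {S} \<inter> space M"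
      by (auto simp: U_def)
    finally show "U k -` {S} \<inter> space M \<in> sets M" .
  qed auto
  have "(\<lambda>\<omega>. U (K \<omega>) \<omega>) \<in> measurable M (count_space UNIV)"
    by (rule measurable_compose_countable[OF U K])
  then have "(\<lambda>\<omega>. SOME i. i \<in> U (K \<omega>) \<omega>) \<in> measurable M (count_space UNIV)"
    by (rule measurable_compose) simp
  then show ?thesis
    by (simp add: escape_def U_def K_def)
qed

lemma measurable_parent [measurable]: "(\<lambda>\<omega>. parent \<omega> x) \<in> measurable noise (count_space UNIV)"
proof -
  have "(\<lambda>\<omega>. escape (\<lambda>k i. blocked \<omega> k i x)) \<in> measurable noise (count_space UNIV)"
    by (rule measurable_escape) measurable
  then show ?thesis
    unfolding parent_def by (rule measurable_compose) simp
qed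

lemma measurable_parent_funpow [measurable]:
  "(\<lambda>\<omega>. (parent \<omega> ^^ n) x) \<in> measurable noise (count_space UNIV)"
proof (induction n)
  case (Suc n)
  show ?case
    using measurable_compose_countable[OF measurable_parent Suc] by simp
qed simp

lemma parent_funpow_bounds:
  "x $ i \<le> ((parent \<omega> ^^ m) x) $ i \<and> ((parent \<omega> ^^ m) x) $ i \<le> x $ i + int m"
  by (induction m) (auto simp: parent_def axis_def)

text \<open>Mass transport: translating by \<open>v\<close> turns the events for different \<open>v\<close> into disjoint parts of the
  event that the origin is trapped.\<close>

lemma measure_trapped_ancestor:
  fixes k m :: nat
  shows "measure noise {\<omega>. \<exists>v :: int ^ 'd. trapped \<omega> k v \<and> (parent \<omega> ^^ m) v = 0} \<le>
           measure noise {\<omega>. trapped \<omega> k (0 :: int ^ 'd)}"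
proof -
  \<comment> \<open>A step never lowers a coordinate and raises it by at most one, so the ancestors
    of the origin after \<open>m\<close> steps back lie in this finite box.\<close>
  define V where "V = {v :: int ^ 'd. \<forall>i. v $ i \<in> {- int m..0}}"
  have V: "finite V" unfolding V_def by (rule finite_vec_box) simp
  have mem_V: "v \<in> V" if "(parent \<omega> ^^ m) v = 0" for v \<omega>
    using parent_funpow_bounds[of v _ m \<omega>] that unfolding V_def
    by (smt (verit) atLeastAtMost_iff mem_Collect_eq zero_index)
  define A where "A v = {\<omega> \<in> space noise. trapped \<omega> k v \<and> (parent \<omega> ^^ m) v = 0}" for v :: "int ^ 'd"
  define A' where "A' v = {\<omega> \<in> space noise. trapped \<omega> k 0 \<and> (parent \<omega> ^^ m) 0 = - v}" for v :: "int ^ 'd"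
  have A: "A v \<in> sets noise" and A': "A' v \<in> sets noise" for v
    unfolding A_def A'_def by measurable
  \<comment> \<open>Translation by \<open>v\<close> moves the site \<open>v\<close> to the origin,
    whose path then reaches \<open>- v\<close>. This endpoint is unique, which makes the events
    \<open>A' v\<close> disjoint.\<close>
  have "A v = translate v -` A' v" for v
    by (auto simp: A_def A'_def trapped_translate parent_funpow_translate)
  then have eq: "measure noise (A v) = measure noise (A' v)" for v
    using measure_translate[OF A'] by simp
  have "{\<omega>. \<exists>v :: int ^ 'd. trapped \<omega> k v \<and> (parent \<omega> ^^ m) v = 0} = (\<Union>v\<in>V. A v)"
    using mem_V by (auto simp: A_def)
  then have "measure noise {\<omega>. \<exists>v :: int ^ 'd. trapped \<omega> k v \<and> (parent \<omega> ^^ m) v = 0} \<le>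
      (\<Sum>v\<in>V. measure noise (A v))"
    using V A by (simp add: measure_UNION_le)
  also have "\<dots> = measure noise (\<Union>v\<in>V. A' v)"
    unfolding eq using V A'
    by (intro noise.finite_measure_finite_Union[symmetric]) (auto simp: disjoint_family_on_def A'_def)
  also have "\<dots> \<le> measure noise {\<omega> \<in> space noise. trapped \<omega> k (0 :: int ^ 'd)}"
    by (intro noise.finite_measure_mono) (auto simp: A'_def intro: measurable_trapped[THEN predE, simplified])
  finally show ?thesis by simp
qed

text \<open>Start the path at the ancestor d 2^k generations before the origin. It meets a trapped
  site before reaching the origin, at one of d 2^k possible generations, and each generation costs
  at most the probability of a trapped origin.\<close>

lemma measure_ancestor:
  fixes n k :: nat
  assumes "CARD('d) * 2 ^ k \<le> n"
  shows "measure noise {\<omega>. \<exists>y :: int ^ 'd. (parent \<omega> ^^ n) y = 0} \<le>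
           real (CARD('d) * 2 ^ k) * (trap_const CARD('d) / (2 ^ k) ^ CARD('d))"
proof -
  define l where "l = CARD('d) * 2 ^ k"
  define A where "A m = {\<omega> \<in> space noise. \<exists>v :: int ^ 'd. trapped \<omega> k v \<and> (parent \<omega> ^^ m) v = 0}" for m
  have A: "A m \<in> sets noise" for m unfolding A_def by measurable
  have "{\<omega>. \<exists>y :: int ^ 'd. (parent \<omega> ^^ n) y = 0} \<subseteq> (\<Union>m\<in>{1..l}. A m)"
  proof
    fix \<omega> assume "\<omega> \<in> {\<omega>. \<exists>y :: int ^ 'd. (parent \<omega> ^^ n) y = 0}"
    then obtain y :: "int ^ 'd" where y: "(parent \<omega> ^^ n) y = 0" by blast
    define z where "z = (parent \<omega> ^^ (n - l)) y"
    obtain m where m: "m < l" "trapped \<omega> k ((parent \<omega> ^^ m) z)"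
      using path_hits_trapped[of k \<omega> z] by (auto simp: l_def)
    have "(parent \<omega> ^^ (l - m)) ((parent \<omega> ^^ m) z) = (parent \<omega> ^^ (l - m + m + (n - l))) y"
      by (simp add: z_def funpow_add)
    also have "l - m + m + (n - l) = n" using m assms by (simp add: l_def)
    finally have "\<omega> \<in> A (l - m)" using m y by (auto simp: A_def)
    then show "\<omega> \<in> (\<Union>m\<in>{1..l}. A m)" using m by (intro UN_I[of "l - m"]) auto
  qed
  then have "measure noise {\<omega>. \<exists>y :: int ^ 'd. (parent \<omega> ^^ n) y = 0} \<le> measure noise (\<Union>m\<in>{1..l}. A m)"
    using A by (intro noise.finite_measure_mono) auto
  also have "\<dots> \<le> (\<Sum>m\<in>{1..l}. measure noise (A m))"
    using A by (intro measure_UNION_le) auto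
  also have "\<dots> \<le> (\<Sum>m\<in>{1..l}. trap_const CARD('d) / (2 ^ k) ^ CARD('d))"
    using order_trans[OF measure_trapped_ancestor measure_trapped]
    by (intro sum_mono) (simp add: A_def)
  finally show ?thesis by (simp add: l_def)
qed

text \<open>Used with the dimension as \<open>c\<close> for the height and with the separation
  constant as \<open>c\<close> for mixing.\<close>

lemma dyadic_scale:
  fixes c n :: nat
  assumes "0 < c" "c \<le> n"
  obtains k where "c * 2 ^ k \<le> n" "n < c * 2 ^ Suc k"
proof -
  define k where "k = (GREATEST k. c * 2 ^ k \<le> n)"
  have bounded: "j \<le> n" if "c * 2 ^ j \<le> n" for j
  proof -
    have "j < 2 ^ j" by simp
    also have "\<dots> \<le> c * 2 ^ j" using assms by simp
    finally show ?thesis using that by linarith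
  qed
  have "c * 2 ^ k \<le> n"
    unfolding k_def by (rule GreatestI_nat[where k = 0 and b = n]) (use assms bounded in auto)
  moreover have "\<not> c * 2 ^ Suc k \<le> n"
  proof
    assume "c * 2 ^ Suc k \<le> n"
    then have "Suc k \<le> k"
      unfolding k_def by (rule Greatest_le_nat) (use bounded in blast)
    then show False by simp
  qed
  ultimately show ?thesis using that by simp
qed

text \<open>For d 2^k \<le> n < 2 d 2^k, the bound of \<open>measure_ancestor\<close> is of order
  2^(-k (d - 1)), which cancels n^(d - 1) up to a constant.\<close>

lemma ancestor_decay:
  fixes n :: nat
  assumes "CARD('d) \<le> n"
  shows "real n ^ (CARD('d) - 1) * measure noise {\<omega>. \<exists>y :: int ^ 'd. (parent \<omega> ^^ n) y = 0} \<le>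
           (2 * real CARD('d)) ^ CARD('d) * trap_const CARD('d)"
proof -
  define d where "d = CARD('d)"
  have d0: "0 < d" by (simp add: d_def)
  have T: "0 \<le> trap_const d"
    using block_const_ge_1[of d] by (simp add: trap_const_def)
  obtain k where lo: "d * 2 ^ k \<le> n" and "n < d * 2 ^ Suc k"
    using dyadic_scale[OF d0] assms unfolding d_def by blast
  then have "n \<le> d * 2 ^ Suc k" by linarith
  then have "real n \<le> real (d * 2 ^ Suc k)" by (simp only: of_nat_le_iff)
  then have hi: "real n \<le> 2 * real d * 2 ^ k" by simp
  have "real n ^ (d - 1) * measure noise {\<omega>. \<exists>y :: int ^ 'd. (parent \<omega> ^^ n) y = 0} \<le>
        (2 * real d * 2 ^ k) ^ (d - 1) * (real (d * 2 ^ k) * (trap_const d / (2 ^ k) ^ d))"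
    using hi measure_ancestor[where 'd = 'd and k = k and n = n] lo
    by (intro mult_mono power_mono) (auto simp: d_def)
  also have "\<dots> \<le> (2 * real d * 2 ^ k) ^ (d - 1) * ((2 * real d * 2 ^ k) * (trap_const d / (2 ^ k) ^ d))"
    using T by (intro mult_left_mono mult_right_mono) auto
  also have "\<dots> = (2 * real d * 2 ^ k) ^ d * (trap_const d / (2 ^ k) ^ d)"
    by (subst power_minus_mult[OF d0, symmetric]) (simp only: mult.assoc)
  also have "\<dots> = (2 * real d) ^ d * trap_const d"
    by (simp add: power_mult_distrib)
  finally show ?thesis by (simp add: d_def)
qed

section \<open>Truncation of the scales\<close>

text \<open>Scales above \<open>K\<close> count as never blocking. The least scale in
  \<open>escape\<close> then always exists, and the map agrees with \<open>parent\<close> at sites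
  where no scale above \<open>K\<close> blocks.\<close>

definition parent_upto :: "nat \<Rightarrow> (nat \<times> (int ^ 'd) \<Rightarrow> real) \<Rightarrow> int ^ 'd \<Rightarrow> int ^ 'd" where
  "parent_upto K \<omega> x = x + axis (escape (\<lambda>k i. k \<le> K \<and> blocked \<omega> k i x)) 1"

text \<open>The extra 1 in the side makes room for the window moved by one step.\<close>

lemma window_subset_reach:
  assumes "k \<le> K"
  shows "window (2 ^ k) x \<union> window (2 ^ k) (x + axis i 1) \<subseteq> window (2 ^ K + 1) x"
proof -
  have le: "(2 :: int) ^ k \<le> 2 ^ K" using assms by simp
  have "c \<in> window (2 ^ K + 1) x" if "c \<in> window (2 ^ k) (x + axis j 1) \<or> c \<in> window (2 ^ k) x" for c j
    unfolding window_def
  proof (intro CollectI allI)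
    fix l
    have "0 \<le> axis j (1::int) $ l" "axis j (1::int) $ l \<le> 1" by (auto simp: axis_def)
    moreover have "x $ l + axis j 1 $ l \<le> c $ l \<and> c $ l < x $ l + axis j 1 $ l + 2 ^ k \<or>
        x $ l \<le> c $ l \<and> c $ l < x $ l + 2 ^ k"
      using that by (auto simp: window_def)
    ultimately show "x $ l \<le> c $ l \<and> c $ l < x $ l + int (2 ^ K + 1)"
      using le unfolding of_nat_add of_nat_power of_nat_numeral of_nat_1 by (smt (verit))
  qed
  then show ?thesis by blast
qed

lemma parent_upto_cong:
  assumes "\<And>k c. k \<le> K \<Longrightarrow> c \<in> window (2 ^ K + 1) x \<Longrightarrow> \<omega> (k, c) = \<omega>' (k, c)"
  shows "parent_upto K \<omega> x = parent_upto K \<omega>' x"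
proof -
  have "(k \<le> K \<and> blocked \<omega> k i x) = (k \<le> K \<and> blocked \<omega>' k i x)" for k i
    using window_subset_reach[of k K x i] assms by (intro conj_cong refl blocked_cong) blast
  then show ?thesis by (simp add: parent_upto_def)
qed

lemma measurable_parent_upto:
  assumes "\<And>k c. k \<le> K \<Longrightarrow> c \<in> window (2 ^ K + 1) x \<Longrightarrow> (\<lambda>\<omega>. f \<omega> (k, c)) \<in> borel_measurable M"
  shows "(\<lambda>\<omega>. parent_upto K (f \<omega>) x) \<in> measurable M (count_space UNIV)"
proof -
  have "Measurable.pred M (\<lambda>\<omega>. k \<le> K \<and> blocked (f \<omega>) k i x)" for k i
  proof (cases "k \<le> K")
    case True
    then have "Measurable.pred M (\<lambda>\<omega>. blocked (f \<omega>) k i x)"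
      using window_subset_reach[OF True, of x i] assms by (intro pred_blocked) blast
    then show ?thesis using True by simp
  qed simp
  then have "(\<lambda>\<omega>. escape (\<lambda>k i. k \<le> K \<and> blocked (f \<omega>) k i x)) \<in> measurable M (count_space UNIV)"
    by (rule measurable_escape)
  then show ?thesis
    unfolding parent_upto_def by (rule measurable_compose) simp
qed

lemma measure_parent_upto_neq:
  fixes x :: "int ^ 'd"
  shows "measure noise {\<omega>. parent_upto K \<omega> x \<noteq> parent \<omega> x} \<le>
           real CARD('d) * block_const CARD('d) * (1 / 2) ^ K"
proof -
  have "{\<omega>. parent_upto K \<omega> x \<noteq> parent \<omega> x} \<subseteq> {\<omega> \<in> space noise. \<exists>j>K. \<exists>i. blocked \<omega> j i x}"
  proof
    fix \<omega> assume neq: "\<omega> \<in> {\<omega>. parent_upto K \<omega> x \<noteq> parent \<omega> x}"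
    show "\<omega> \<in> {\<omega> \<in> space noise. \<exists>j>K. \<exists>i. blocked \<omega> j i x}"
    proof (rule ccontr)
      assume "\<not> ?thesis"
      then have "(\<lambda>k i. k \<le> K \<and> blocked \<omega> k i x) = (\<lambda>k i. blocked \<omega> k i x)"
        by (auto simp: fun_eq_iff not_less)
      then show False using neq by (simp add: parent_upto_def parent_def)
    qed
  qed
  then have "measure noise {\<omega>. parent_upto K \<omega> x \<noteq> parent \<omega> x} \<le>
      measure noise {\<omega> \<in> space noise. \<exists>j>K. \<exists>i. blocked \<omega> j i x}"
    by (rule noise.finite_measure_mono) measurable
  then show ?thesis using measure_blocked_tail[of K x] by simp
qed

section \<open>Local observables and covariance estimates\<close>

text \<open>The restrictions to a finite \<open>G\<close> form a discrete space, on which every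
  \<open>\<Phi>\<close> is measurable.\<close>

lemma measurable_local_config:
  fixes \<Phi> :: "('i \<Rightarrow> 'b::countable) \<Rightarrow> real"
  assumes "finite G" "\<And>y. y \<in> G \<Longrightarrow> (\<lambda>\<omega>. h \<omega> y) \<in> measurable M (count_space UNIV)"
  shows "(\<lambda>\<omega>. \<Phi> (restrict (h \<omega>) G)) \<in> borel_measurable M"
proof -
  have "(\<lambda>\<omega>. restrict (h \<omega>) G) \<in> measurable M (PiM G (\<lambda>_. count_space UNIV))"
    using assms(2) by (rule measurable_restrict)
  also have "PiM G (\<lambda>_. count_space UNIV) = count_space (PiE G (\<lambda>_. UNIV :: 'b set))"
    using assms(1) by (intro count_space_PiM_finite) auto
  finally show ?thesis
    by (rule measurable_compose) simp
qed

lemma generated_algebra_cong: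
  assumes "A \<in> sets (generated_algebra M N b G)"
    and "\<omega> \<in> space M" "\<omega>' \<in> space M" "\<And>y. y \<in> G \<Longrightarrow> b y \<omega> = b y \<omega>'"
  shows "\<omega> \<in> A \<longleftrightarrow> \<omega>' \<in> A"
proof -
  have "{b y -` A \<inter> space M | y A. y \<in> G \<and> A \<in> sets N} \<subseteq> Pow (space M)" by auto
  then have "A \<in> sigma_sets (space M) {b y -` A \<inter> space M | y A. y \<in> G \<and> A \<in> sets N}"
    using assms(1) by (simp add: generated_algebra_def)
  then show ?thesis
    by (induction rule: sigma_sets.induct) (use assms in auto)
qed

lemma space_generated_algebra [simp]: "space (generated_algebra M N b G) = space M"
  unfolding generated_algebra_def by (rule space_measure_of) auto

text \<open>A Doob-Dynkin factorisation, obtained pointwise: level sets of \<open>f\<close> lie in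
  the generated sigma-algebra and cannot separate points with the same restriction. It lets
  observables be transported to the space of labels.\<close>

lemma local_observable_factor:
  assumes "f \<in> local_observables M N b G"
  obtains \<Phi> where "\<And>u. \<bar>\<Phi> u\<bar> \<le> (1::real)"
    and "\<And>\<omega>. \<omega> \<in> space M \<Longrightarrow> f \<omega> = \<Phi> (restrict (\<lambda>y. b y \<omega>) G)"
proof -
  let ?r = "\<lambda>\<omega>. restrict (\<lambda>y. b y \<omega>) G"
  \<comment> \<open>The value 0 off the range keeps the bound valid for all arguments.\<close>
  define \<Phi> where "\<Phi> u = (if u \<in> ?r ` space M then f (inv_into (space M) ?r u) else 0)" for u
  have meas: "f \<in> borel_measurable (generated_algebra M N b G)"
    and bound: "\<And>\<omega>. \<omega> \<in> space M \<Longrightarrow> \<bar>f \<omega>\<bar> \<le> 1"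
    using assms by (auto simp: local_observables_def)
  have cong: "f \<omega> = f \<omega>'" if "\<omega> \<in> space M" "\<omega>' \<in> space M" "?r \<omega> = ?r \<omega>'" for \<omega> \<omega>'
  proof -
    have "f -` {f \<omega>} \<inter> space M \<in> sets (generated_algebra M N b G)"
      using measurable_sets[OF meas, of "{f \<omega>}"] by simp
    moreover have "b y \<omega> = b y \<omega>'" if "y \<in> G" for y
      using fun_cong[OF \<open>?r \<omega> = ?r \<omega>'\<close>, of y] that by simp
    ultimately have "\<omega> \<in> f -` {f \<omega>} \<inter> space M \<longleftrightarrow> \<omega>' \<in> f -` {f \<omega>} \<inter> space M"
      using that by (intro generated_algebra_cong)
    then show ?thesis using that by simp
  qed
  show ?thesis
  proof
    show "\<bar>\<Phi> u\<bar> \<le> 1" for u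
      using bound by (auto simp: \<Phi>_def inv_into_into)
    show "f \<omega> = \<Phi> (?r \<omega>)" if \<omega>: "\<omega> \<in> space M" for \<omega>
    proof -
      have mem: "?r \<omega> \<in> ?r ` space M" using \<omega> by blast
      then have "f \<omega> = f (inv_into (space M) ?r (?r \<omega>))"
        by (intro cong \<omega> inv_into_into f_inv_into_f[symmetric])
      with mem show ?thesis unfolding \<Phi>_def by (simp only: if_True)
    qed
  qed
qed

lemma (in prob_space) integrable_abs_le_1:
  fixes f :: "'a \<Rightarrow> real"
  assumes "f \<in> borel_measurable M" "\<And>\<omega>. \<bar>f \<omega>\<bar> \<le> (1::real)"
  shows "integrable M f"
  using assms by (intro integrable_const_bound[of _ 1] AE_I2) simp_all

lemma abs_mult_le_1: "\<bar>x\<bar> \<le> 1 \<Longrightarrow> \<bar>y\<bar> \<le> 1 \<Longrightarrow> \<bar>x * y\<bar> \<le> (1::real)"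
  by (simp add: abs_mult mult_le_one)

lemma (in prob_space) cov_eq:
  assumes "f \<in> borel_measurable M" "g \<in> borel_measurable M"
    and "\<And>\<omega>. \<bar>f \<omega>\<bar> \<le> 1" "\<And>\<omega>. \<bar>g \<omega>\<bar> \<le> 1"
  shows "cov M f g = expectation (\<lambda>\<omega>. f \<omega> * g \<omega>) - expectation f * expectation g"
proof -
  have [simp]: "integrable M f" "integrable M g" "integrable M (\<lambda>\<omega>. f \<omega> * g \<omega>)"
    using assms by (auto intro!: integrable_abs_le_1 abs_mult_le_1)
  have "(f \<omega> - expectation f) * (g \<omega> - expectation g) =
      f \<omega> * g \<omega> - expectation f * g \<omega> - expectation g * f \<omega> + expectation f * expectation g" for \<omega>
    by (simp add: algebra_simps)
  then show ?thesis by (simp add: cov_def prob_space)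
qed

lemma (in prob_space) abs_expectation_le_1:
  fixes f :: "'a \<Rightarrow> real"
  assumes "f \<in> borel_measurable M" "\<And>\<omega>. \<bar>f \<omega>\<bar> \<le> 1"
  shows "\<bar>expectation f\<bar> \<le> 1"
proof -
  have "\<bar>expectation f\<bar> \<le> expectation (\<lambda>\<omega>. \<bar>f \<omega>\<bar>)" by (rule integral_abs_bound)
  also have "\<dots> \<le> 1"
    using assms by (intro integral_le_const integrable_abs integrable_abs_le_1 AE_I2)
  finally show ?thesis .
qed

lemma (in prob_space) abs_cov_le_2:
  assumes "f \<in> borel_measurable M" "g \<in> borel_measurable M"
    and "\<And>\<omega>. \<bar>f \<omega>\<bar> \<le> 1" "\<And>\<omega>. \<bar>g \<omega>\<bar> \<le> 1"
  shows "\<bar>cov M f g\<bar> \<le> 2"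
proof -
  have "\<bar>expectation (\<lambda>\<omega>. f \<omega> * g \<omega>)\<bar> \<le> 1"
    using assms by (intro abs_expectation_le_1 abs_mult_le_1) auto
  moreover have "\<bar>expectation f * expectation g\<bar> \<le> 1"
    using assms by (intro abs_expectation_le_1 abs_mult_le_1)
  ultimately show ?thesis unfolding cov_eq[OF assms] by linarith
qed

lemma (in prob_space) expectation_close:
  assumes "f \<in> borel_measurable M" "g \<in> borel_measurable M" and D: "D \<in> events"
    and "\<And>\<omega>. \<bar>f \<omega>\<bar> \<le> 1" "\<And>\<omega>. \<bar>g \<omega>\<bar> \<le> 1"
    and "\<And>\<omega>. \<omega> \<in> space M - D \<Longrightarrow> f \<omega> = g \<omega>"
  shows "\<bar>expectation f - expectation g\<bar> \<le> 2 * prob D"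
proof -
  have [simp]: "integrable M f" "integrable M g"
    using assms by (auto intro!: integrable_abs_le_1)
  have "\<bar>expectation f - expectation g\<bar> = \<bar>expectation (\<lambda>\<omega>. f \<omega> - g \<omega>)\<bar>" by simp
  also have "\<dots> \<le> expectation (\<lambda>\<omega>. \<bar>f \<omega> - g \<omega>\<bar>)" by (rule integral_abs_bound)
  also have "\<dots> \<le> expectation (\<lambda>\<omega>. 2 * indicator D \<omega>)"
  proof (rule integral_mono)
    fix \<omega> assume "\<omega> \<in> space M"
    have "\<bar>f \<omega> - g \<omega>\<bar> \<le> 2" using assms(4,5)[of \<omega>] by linarith
    then show "\<bar>f \<omega> - g \<omega>\<bar> \<le> 2 * indicator D \<omega>"
      using assms(6)[of \<omega>] \<open>\<omega> \<in> space M\<close> by (auto simp: indicator_def)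
  qed (use D in \<open>auto simp: emeasure_eq_measure\<close>)
  also have "\<dots> = 2 * prob D" using D by simp
  finally show ?thesis .
qed

text \<open>The covariance of \<open>f'\<close> and \<open>g'\<close> vanishes. Replacing them by
  \<open>f\<close> and \<open>g\<close> costs at most \<open>2 * prob D\<close> in the expectation
  of the product and \<open>4 * prob D\<close> in the product of the expectations.\<close>

lemma (in prob_space) cov_close:
  assumes "f \<in> borel_measurable M" "g \<in> borel_measurable M" "f' \<in> borel_measurable M" "g' \<in> borel_measurable M"
    and D: "D \<in> events"
    and b: "\<And>\<omega>. \<bar>f \<omega>\<bar> \<le> 1" "\<And>\<omega>. \<bar>g \<omega>\<bar> \<le> 1" "\<And>\<omega>. \<bar>f' \<omega>\<bar> \<le> 1" "\<And>\<omega>. \<bar>g' \<omega>\<bar> \<le> 1"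
    and eq: "\<And>\<omega>. \<omega> \<in> space M - D \<Longrightarrow> f \<omega> = f' \<omega>" "\<And>\<omega>. \<omega> \<in> space M - D \<Longrightarrow> g \<omega> = g' \<omega>"
    and ind: "indep_var borel f' borel g'"
  shows "\<bar>cov M f g\<bar> \<le> 6 * prob D"
proof -
  have int: "integrable M f'" "integrable M g'"
    using assms by (auto intro!: integrable_abs_le_1)
  have ind': "expectation (\<lambda>\<omega>. f' \<omega> * g' \<omega>) = expectation f' * expectation g'"
    using ind int by (rule indep_var_lebesgue_integral)
  have "\<bar>expectation (\<lambda>\<omega>. f \<omega> * g \<omega>) - expectation (\<lambda>\<omega>. f' \<omega> * g' \<omega>)\<bar> \<le> 2 * prob D"
    using assms by (intro expectation_close) (auto intro!: abs_mult_le_1)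
  moreover have f: "\<bar>expectation f - expectation f'\<bar> \<le> 2 * prob D"
    and g: "\<bar>expectation g - expectation g'\<bar> \<le> 2 * prob D"
    using assms by (auto intro!: expectation_close)
  have "\<bar>expectation f * expectation g - expectation f' * expectation g'\<bar> \<le> 2 * prob D + 2 * prob D"
  proof -
    have "\<bar>expectation f * expectation g - expectation f' * expectation g'\<bar> =
        \<bar>(expectation f - expectation f') * expectation g + expectation f' * (expectation g - expectation g')\<bar>"
      by (simp add: algebra_simps)
    also have "\<dots> \<le> \<bar>expectation f - expectation f'\<bar> * \<bar>expectation g\<bar> + \<bar>expectation f'\<bar> * \<bar>expectation g - expectation g'\<bar>"
      unfolding abs_mult[symmetric] by (rule abs_triangle_ineq)
    also have "\<dots> \<le> \<bar>expectation f - expectation f'\<bar> * 1 + 1 * \<bar>expectation g - expectation g'\<bar>"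
      using assms by (intro add_mono mult_mono abs_expectation_le_1) auto
    finally show ?thesis using f g by simp
  qed
  ultimately show ?thesis
    using cov_eq[OF assms(1,2) b(1,2)] ind' by linarith
qed

section \<open>Mixing and the law of the parent function\<close>

text \<open>Each observable is a function of the labels at scales up to \<open>K\<close> in the
  windows of its sites, and these index sets are disjoint.\<close>

lemma indep_parent_upto:
  fixes G H :: "(int ^ 'd) set" and \<Phi> \<Psi> :: "(int ^ 'd \<Rightarrow> int ^ 'd) \<Rightarrow> real"
  assumes "finite G" "finite H"
    and disj: "\<And>x y. x \<in> G \<Longrightarrow> y \<in> H \<Longrightarrow> window (2 ^ K + 1) x \<inter> window (2 ^ K + 1) y = {}"
  shows "noise.indep_var borel (\<lambda>\<omega>. \<Phi> (restrict (parent_upto K \<omega>) G))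
                         borel (\<lambda>\<omega>. \<Psi> (restrict (parent_upto K \<omega>) H))"
proof -
  let ?U = "\<lambda>_ :: nat \<times> (int ^ 'd). uniform_measure lborel {0..1::real}"
  define S where "S E = {..K} \<times> (\<Union>x\<in>E. window (2 ^ K + 1) x)" for E :: "(int ^ 'd) set"
  have local: "(\<lambda>u. \<Theta> (restrict (parent_upto K u) E)) \<in> borel_measurable (PiM (S E) ?U)"
    if "finite E" for \<Theta> :: "(int ^ 'd \<Rightarrow> int ^ 'd) \<Rightarrow> real" and E
  proof (intro measurable_local_config that measurable_parent_upto)
    fix y k c assume "y \<in> E" "k \<le> K" "c \<in> window (2 ^ K + 1) y"
    then show "(\<lambda>u. u (k, c)) \<in> borel_measurable (PiM (S E) ?U)"
      using measurable_component_singleton[of "(k, c)" "S E" ?U]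
      by (auto simp: S_def cong: measurable_cong_sets)
  qed
  have restr: "\<Theta> (restrict (parent_upto K (restrict \<omega> (S E))) E) = \<Theta> (restrict (parent_upto K \<omega>) E)"
    for \<omega> E and \<Theta> :: "(int ^ 'd \<Rightarrow> int ^ 'd) \<Rightarrow> real"
  proof -
    have "parent_upto K (restrict \<omega> (S E)) x = parent_upto K \<omega> x" if "x \<in> E" for x
      using that by (intro parent_upto_cong) (auto simp: S_def)
    then show ?thesis by (intro arg_cong[where f = \<Theta>]) (auto simp: restrict_def)
  qed
  have "S G \<inter> S H = {}" using disj by (auto simp: S_def)
  then have "noise.indep_var (PiM (S G) ?U) (\<lambda>\<omega>. restrict (\<lambda>p. \<omega> p) (S G))
      (PiM (S H) ?U) (\<lambda>\<omega>. restrict (\<lambda>p. \<omega> p) (S H))"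
    by (intro noise.indep_var_restrict[OF indep_noise]) auto
  from noise.indep_var_compose[OF this local[OF assms(1), of \<Phi>] local[OF assms(2), of \<Psi>]]
  show ?thesis by (simp add: comp_def restr)
qed

text \<open>Unless truncation changes the parent of some site of \<open>G\<close> or
  \<open>H\<close>, the observables equal their truncated versions, which are independent.\<close>

lemma cov_parent:
  fixes G H :: "(int ^ 'd) set" and \<Phi> \<Psi> :: "(int ^ 'd \<Rightarrow> int ^ 'd) \<Rightarrow> real"
  assumes fin: "finite G" "finite H"
    and disj: "\<And>x y. x \<in> G \<Longrightarrow> y \<in> H \<Longrightarrow> window (2 ^ K + 1) x \<inter> window (2 ^ K + 1) y = {}"
    and \<Phi>: "\<And>u. \<bar>\<Phi> u\<bar> \<le> 1" and \<Psi>: "\<And>u. \<bar>\<Psi> u\<bar> \<le> 1"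
  shows "\<bar>cov noise (\<lambda>\<omega>. \<Phi> (restrict (parent \<omega>) G)) (\<lambda>\<omega>. \<Psi> (restrict (parent \<omega>) H))\<bar> \<le>
           6 * (real (card G + card H) * (real CARD('d) * block_const CARD('d) * (1 / 2) ^ K))"
proof -
  have upto [measurable]: "(\<lambda>\<omega>. parent_upto K \<omega> x) \<in> measurable noise (count_space UNIV)" for x :: "int ^ 'd"
    by (intro measurable_parent_upto noise_component)
  define N where "N x = {\<omega> \<in> space noise. parent_upto K \<omega> x \<noteq> parent \<omega> x}" for x :: "int ^ 'd"
  have N: "N x \<in> sets noise" for x unfolding N_def by measurable
  define D where "D = (\<Union>x\<in>G \<union> H. N x)"
  have D: "D \<in> sets noise" unfolding D_def using fin N by auto
  have eq: "restrict (parent \<omega>) E = restrict (parent_upto K \<omega>) E"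
    if "\<omega> \<in> space noise - D" "E \<subseteq> G \<union> H" for \<omega> E
    using that by (auto simp: D_def N_def restrict_def fun_eq_iff)
  have "\<bar>cov noise (\<lambda>\<omega>. \<Phi> (restrict (parent \<omega>) G)) (\<lambda>\<omega>. \<Psi> (restrict (parent \<omega>) H))\<bar> \<le> 6 * measure noise D"
    using fin D eq
    by (intro noise.cov_close[where f' = "\<lambda>\<omega>. \<Phi> (restrict (parent_upto K \<omega>) G)"
          and g' = "\<lambda>\<omega>. \<Psi> (restrict (parent_upto K \<omega>) H)"]
        measurable_local_config measurable_parent upto \<Phi> \<Psi> indep_parent_upto disj) auto
  also have "measure noise D \<le> (\<Sum>x\<in>G \<union> H. measure noise (N x))"
    unfolding D_def using fin N by (intro measure_UNION_le) auto
  also have "\<dots> \<le> (\<Sum>x\<in>G \<union> H. real CARD('d) * block_const CARD('d) * (1 / 2) ^ K)"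
    using measure_parent_upto_neq by (intro sum_mono) (simp add: N_def)
  also have "\<dots> \<le> real (card G + card H) * (real CARD('d) * block_const CARD('d) * (1 / 2) ^ K)"
    using block_const_ge_1[of "CARD('d)"] unfolding sum_constant
    by (intro mult_right_mono of_nat_mono card_Un_le) auto
  finally show ?thesis by simp
qed

text \<open>If two such windows meet, every coordinate of \<open>s\<close> is at most 2^K plus twice
  a bound on the coordinates in \<open>G\<close>.\<close>

lemma translated_windows_disjoint:
  fixes G :: "(int ^ 'd) set"
  assumes "finite G"
  obtains c where "0 < c"
    and "\<And>K s x y. int (c * 2 ^ K) \<le> norm1 s \<Longrightarrow> x \<in> G \<Longrightarrow> y \<in> (\<lambda>x. x + s) ` G \<Longrightarrow>
           window (2 ^ K + 1) x \<inter> window (2 ^ K + 1) y = {}"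
proof -
  define D where "D = (\<Sum>x\<in>G. norm1 x)"
  have norm1_nonneg: "0 \<le> norm1 x" for x :: "int ^ 'd" by (simp add: norm1_def sum_nonneg)
  have D0: "0 \<le> D" by (simp add: D_def norm1_nonneg sum_nonneg)
  have D: "\<bar>x $ i\<bar> \<le> D" if "x \<in> G" for x i
  proof -
    have "\<bar>x $ i\<bar> \<le> norm1 x" unfolding norm1_def by (intro member_le_sum) auto
    also have "\<dots> \<le> D" unfolding D_def using assms that norm1_nonneg by (intro member_le_sum) auto
    finally show ?thesis .
  qed
  \<comment> \<open>Chosen so that d (2 D + 2^K) \<le> d (2 D + 1) 2^K < c 2^K; the final 1 makes
    the inequality strict.\<close>
  define c where "c = CARD('d) * (2 * nat D + 1) + 1"
  show ?thesis
  proof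
    show "0 < c" by (simp add: c_def)
    fix K s x y assume s: "int (c * 2 ^ K) \<le> norm1 s" and x: "x \<in> G" and y: "y \<in> (\<lambda>x. x + s) ` G"
    show "window (2 ^ K + 1) x \<inter> window (2 ^ K + 1) y = {}"
    proof (rule ccontr)
      assume "\<not> ?thesis"
      then obtain w where w: "w \<in> window (2 ^ K + 1) x" "w \<in> window (2 ^ K + 1) y" by blast
      obtain z where z: "z \<in> G" "y = z + s" using y by blast
      have "\<bar>s $ i\<bar> \<le> 2 * D + 2 ^ K" for i
      proof -
        have "x $ i \<le> w $ i" "w $ i < x $ i + (2 ^ K + 1)"
          "z $ i + s $ i \<le> w $ i" "w $ i < z $ i + s $ i + (2 ^ K + 1)"
          using w z by (simp_all add: window_def add.commute)
        then show ?thesis using D[OF x, of i] D[OF z(1), of i] by linarith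
      qed
      then have "norm1 s \<le> (\<Sum>i\<in>(UNIV :: 'd set). 2 * D + 2 ^ K)"
        unfolding norm1_def by (intro sum_mono)
      also have "\<dots> = int CARD('d) * (2 * D + 2 ^ K)" by simp
      also have "\<dots> \<le> int CARD('d) * ((2 * D + 1) * 2 ^ K)"
      proof -
        have "2 * D * 1 \<le> 2 * D * 2 ^ K" using D0 by (intro mult_left_mono) auto
        then show ?thesis by (intro mult_left_mono) (auto simp: algebra_simps)
      qed
      also have "\<dots> < int (c * 2 ^ K)"
        using D0 by (simp add: c_def algebra_simps)
      finally show False using s by simp
    qed
  qed
qed

text \<open>The required properties hold for every configuration, not only almost surely, so steps that are
  not axis vectors are replaced by a fixed one; these have probability zero under \<open>parent_law\<close>.\<close>

definition canonical_parent :: "int ^ 'd \<Rightarrow> (int ^ 'd \<Rightarrow> int ^ 'd) \<Rightarrow> int ^ 'd" where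
  "canonical_parent x \<eta> = (if \<exists>i. \<eta> x = x + axis i 1 then \<eta> x else x + axis undefined 1)"

text \<open>The theorem asks for a measure on maps of the lattice, so the space of labels is
  replaced by the law of \<open>parent\<close>.\<close>

definition parent_law :: "(int ^ 'd \<Rightarrow> int ^ 'd) measure" where
  "parent_law = distr noise (PiM UNIV (\<lambda>_. count_space UNIV)) parent"

lemma measurable_parent_law: "parent \<in> measurable noise (PiM UNIV (\<lambda>_. count_space UNIV))"
  by (rule measurable_PiM_single') auto

lemma prob_space_parent_law: "prob_space parent_law"
  unfolding parent_law_def by (intro noise.prob_space_distr measurable_parent_law)

lemma space_parent_law [simp]: "space parent_law = UNIV"
  by (simp add: parent_law_def space_PiM)

lemma sets_parent_law [measurable_cong]: "sets parent_law = sets (PiM UNIV (\<lambda>_. count_space UNIV))"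
  by (simp add: parent_law_def)

lemma canonical_parent_parent: "canonical_parent x (parent \<omega>) = parent \<omega> x"
  by (auto simp: canonical_parent_def parent_def)

lemma canonical_parent_axis: "\<exists>i. canonical_parent x \<eta> = x + axis i 1"
  by (auto simp: canonical_parent_def)

lemma measurable_canonical_parent [measurable]:
  "canonical_parent x \<in> measurable parent_law (count_space UNIV)"
proof -
  have "(\<lambda>\<eta>. \<eta> x) \<in> measurable parent_law (count_space UNIV)" by measurable
  then show ?thesis
    unfolding canonical_parent_def[abs_def] by (rule measurable_compose) simp
qed

text \<open>By \<open>parent_translate\<close>, shifting the increments amounts to translating the
  labels, whose law is invariant.\<close>

lemma stationary_canonical_parent: "stationary parent_law (canonical_parent :: int ^ 'd \<Rightarrow> _)"
  unfolding stationary_def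
proof
  fix s :: "int ^ 'd"
  let ?P = "PiM UNIV (\<lambda>_. count_space UNIV) :: (int ^ 'd \<Rightarrow> int ^ 'd) measure"
  define F where "F = (\<lambda>\<omega> x. parent \<omega> x - x :: int ^ 'd)"
  have meas: "(\<lambda>\<eta> x. canonical_parent (x + t) \<eta> - (x + t)) \<in> measurable parent_law ?P" for t :: "int ^ 'd"
    by (rule measurable_PiM_single') (auto intro: measurable_compose[OF measurable_canonical_parent])
  have F: "F \<in> measurable noise ?P"
    unfolding F_def by (rule measurable_PiM_single') (auto intro: measurable_compose[OF measurable_parent])
  have law: "distr parent_law ?P (\<lambda>\<eta> x. canonical_parent (x + t) \<eta> - (x + t)) =
      distr noise ?P (\<lambda>\<omega> x. parent \<omega> (x + t) - (x + t))" for t :: "int ^ 'd"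
    using distr_distr[OF meas[of t, unfolded measurable_cong_sets[OF sets_parent_law refl]] measurable_parent_law]
    by (simp add: parent_law_def comp_def canonical_parent_parent)
  have "(\<lambda>\<omega> x. parent \<omega> (x + s) - (x + s)) = F \<circ> translate s"
    by (simp add: F_def fun_eq_iff parent_translate algebra_simps)
  then have "distr noise ?P (\<lambda>\<omega> x. parent \<omega> (x + s) - (x + s)) = distr (distr noise noise (translate s)) ?P F"
    using F by (simp add: distr_distr)
  also have "\<dots> = distr noise ?P (\<lambda>\<omega> x. parent \<omega> (x + 0) - (x + 0))"
    by (simp add: distr_translate F_def)
  finally show "distr parent_law ?P (\<lambda>\<eta> x. canonical_parent (x + s) \<eta> - (x + s)) =
      distr parent_law ?P (\<lambda>\<eta> x. canonical_parent x \<eta> - x)"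
    using law[of s] law[of 0] by simp
qed

lemma ancestral_function_canonical_parent: "ancestral_function parent_law canonical_parent"
  unfolding ancestral_function_def
  by (intro conjI allI ballI measurable_canonical_parent directed_step canonical_parent_axis)

lemma directed_canonical_parent: "directed parent_law canonical_parent"
  unfolding directed_def
proof (intro exI conjI allI AE_I2)
  fix \<eta> :: "int ^ 'd \<Rightarrow> int ^ 'd" and x
  obtain i where "canonical_parent x \<eta> = x + axis i 1" using canonical_parent_axis by blast
  then show "canonical_parent x \<eta> - x \<in> {(1 :: int ^ 'd) $ i *s axis i 1 | i. True}" by auto
qed simp

text \<open>Choose K with c 2^K \<le> |s| < 2 c 2^K. The windows of \<open>G\<close> and of its
  translate are then disjoint, the covariance is at most A 2^(-K), and the factor |s| turns this
  into at most 2 c A. For |s| < c the bound 2 on the covariance suffices; the summand 1 in A + 1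
  covers this case.\<close>

lemma polynomially_mixing_canonical_parent:
  "polynomially_mixing parent_law (count_space UNIV) (canonical_parent :: int ^ 'd \<Rightarrow> _) 1"
  unfolding polynomially_mixing_def
proof (intro allI impI)
  let ?obs = "local_observables parent_law (count_space UNIV) (canonical_parent :: int ^ 'd \<Rightarrow> _)"
  fix G :: "(int ^ 'd) set" assume G: "finite G"
  obtain c where c: "0 < c" and disj: "\<And>K s x y. int (c * 2 ^ K) \<le> norm1 s \<Longrightarrow> x \<in> G \<Longrightarrow>
      y \<in> (\<lambda>x. x + s) ` G \<Longrightarrow> window (2 ^ K + 1) x \<inter> window (2 ^ K + 1) y = {}"
    using translated_windows_disjoint[OF G] by metis
  define A where "A = 6 * (real (2 * card G) * (real CARD('d) * block_const CARD('d)))"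
  have A0: "0 \<le> A" using block_const_ge_1[of "CARD('d)"] by (simp add: A_def)
  have bound: "real_of_int (norm1 s) * \<bar>cov parent_law f g\<bar> \<le> 2 * real c * (A + 1)"
    if f: "f \<in> ?obs G" and g: "g \<in> ?obs ((\<lambda>x. x + s) ` G)" for s f g
  proof -
    let ?H = "(\<lambda>x. x + s) ` G"
    have H: "finite ?H" "card ?H \<le> card G" using G by (auto intro: card_image_le)
    obtain \<Phi> where \<Phi>: "\<And>u. \<bar>\<Phi> u\<bar> \<le> 1" "\<And>\<eta>. f \<eta> = \<Phi> (restrict (\<lambda>y. canonical_parent y \<eta>) G)"
      using local_observable_factor[OF f] by auto
    obtain \<Psi> where \<Psi>: "\<And>u. \<bar>\<Psi> u\<bar> \<le> 1" "\<And>\<eta>. g \<eta> = \<Psi> (restrict (\<lambda>y. canonical_parent y \<eta>) ?H)"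
      using local_observable_factor[OF g] by auto
    have meas: "f \<in> borel_measurable parent_law" "g \<in> borel_measurable parent_law"
      unfolding \<Phi>(2)[abs_def] \<Psi>(2)[abs_def]
      using G H by (auto intro!: measurable_local_config measurable_canonical_parent)
    let ?f = "\<lambda>\<omega>. \<Phi> (restrict (parent \<omega>) G)" and ?g = "\<lambda>\<omega>. \<Psi> (restrict (parent \<omega>) ?H)"
    have fg: "f (parent \<omega>) = ?f \<omega>" "g (parent \<omega>) = ?g \<omega>" for \<omega>
      by (simp_all add: \<Phi> \<Psi> canonical_parent_parent)
    have "cov parent_law f g = cov noise ?f ?g"
      using meas unfolding cov_def parent_law_def
      by (simp add: integral_distr[OF measurable_parent_law] fg cong: measurable_cong_sets)
    then have cov: "\<bar>cov parent_law f g\<bar> = \<bar>cov noise ?f ?g\<bar>" by simp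
    have meas': "?f \<in> borel_measurable noise" "?g \<in> borel_measurable noise"
      using G H by (auto intro!: measurable_local_config measurable_parent)
    define n where "n = nat (norm1 s)"
    have n: "norm1 s = int n" by (simp add: n_def norm1_def sum_nonneg)
    show ?thesis
    proof (cases "c \<le> n")
      case False
      have "\<bar>cov noise ?f ?g\<bar> \<le> 2" by (intro noise.abs_cov_le_2 meas' \<Phi> \<Psi>)
      then have "real n * \<bar>cov noise ?f ?g\<bar> \<le> real c * 2"
        using False by (intro mult_mono) auto
      also have "\<dots> \<le> 2 * real c * (A + 1)" using A0 c by simp
      finally show ?thesis by (simp add: n cov)
    next
      case True
      obtain K where K: "c * 2 ^ K \<le> n" "n < c * 2 ^ Suc K" by (rule dyadic_scale[OF c True])
      have "int (c * 2 ^ K) \<le> norm1 s" unfolding n of_nat_le_iff by (rule K(1))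
      then have "\<bar>cov noise ?f ?g\<bar> \<le> 6 * (real (card G + card ?H) * (real CARD('d) * block_const CARD('d) * (1 / 2) ^ K))"
        by (intro cov_parent disj G H \<Phi> \<Psi>)
      also have "\<dots> \<le> 6 * (real (card G + card G) * (real CARD('d) * block_const CARD('d) * (1 / 2) ^ K))"
        using H block_const_ge_1[of "CARD('d)"] by (intro mult_left_mono mult_right_mono) auto
      also have "\<dots> = A * (1 / 2) ^ K" by (simp add: A_def)
      finally have "real n * \<bar>cov noise ?f ?g\<bar> \<le> real (c * 2 ^ Suc K) * (A * (1 / 2) ^ K)"
        using K A0 by (intro mult_mono) (auto simp del: of_nat_mult of_nat_power)
      also have "\<dots> = 2 * real c * A" by (simp add: power_one_over)
      also have "\<dots> \<le> 2 * real c * (A + 1)" by (intro mult_left_mono) auto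
      finally show ?thesis by (simp add: n cov)
    qed
  qed
  have "(SUP s. SUP f \<in> ?obs G. SUP g \<in> ?obs ((\<lambda>x. x + s) ` G).
      ereal (real_of_int (norm1 s) powr 1 * \<bar>cov parent_law f g\<bar>)) \<le> ereal (2 * real c * (A + 1))"
    using bound by (intro SUP_least) (simp add: norm1_def sum_nonneg)
  also have "\<dots> < \<infinity>" by simp
  finally show "(SUP s. SUP f \<in> ?obs G. SUP g \<in> ?obs ((\<lambda>x. x + s) ` G).
      ereal (real_of_int (norm1 s) powr 1 * \<bar>cov parent_law f g\<bar>)) < \<infinity>" .
qed

section \<open>The height and the final estimate\<close>

text \<open>A path of m \<ge> n steps to \<open>x\<close> contains one of exactly n steps. The
  height event thus takes the form bounded in \<open>ancestor_decay\<close>.\<close>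

lemma ancestral_height_ge_iff: "enat n \<le> ancestral_height \<alpha> x \<longleftrightarrow> (\<exists>y. (\<alpha> ^^ n) y = x)"
proof
  assume le: "enat n \<le> ancestral_height \<alpha> x"
  have "\<exists>m\<ge>n. \<exists>y. x = (\<alpha> ^^ m) y"
  proof (cases n)
    case 0
    then show ?thesis by (intro exI[of _ 0]) auto
  next
    case (Suc n')
    \<comment> \<open>The supremum may be infinite and not attained; a strict lower bound passes to
      some element of the set.\<close>
    then have "enat n' < Sup {enat n | n. \<exists>y. x = (\<alpha> ^^ n) y}"
      using le by (simp add: ancestral_height_def Suc_ile_eq)
    then obtain m y where "n' < m" "x = (\<alpha> ^^ m) y"
      unfolding less_Sup_iff by auto
    then show ?thesis using Suc by (intro exI[of _ m]) auto
  qed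
  then obtain m y where m: "n \<le> m" and x: "x = (\<alpha> ^^ m) y" by blast
  have "(\<alpha> ^^ n) ((\<alpha> ^^ (m - n)) y) = (\<alpha> ^^ (n + (m - n))) y" by (simp add: funpow_add)
  then show "\<exists>y. (\<alpha> ^^ n) y = x" using m x by auto
qed (auto simp: ancestral_height_def intro: Sup_upper)

lemma measure_height_canonical_parent:
  "measure parent_law {\<eta> \<in> space parent_law. enat n \<le> ancestral_height (\<lambda>x. canonical_parent x \<eta>) (0 :: int ^ 'd)} =
     measure noise {\<omega>. \<exists>y :: int ^ 'd. (parent \<omega> ^^ n) y = 0}"
proof -
  have [measurable]: "(\<lambda>\<eta>. ((\<lambda>x. canonical_parent x \<eta>) ^^ m) y) \<in> measurable parent_law (count_space UNIV)"
    for m and y :: "int ^ 'd"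
  proof (induction m)
    case (Suc m)
    show ?case
      using measurable_compose_countable[OF measurable_canonical_parent Suc] by simp
  qed simp
  have sets: "{\<eta> \<in> space parent_law. \<exists>y :: int ^ 'd. ((\<lambda>x. canonical_parent x \<eta>) ^^ n) y = 0} \<in> sets parent_law"
    by measurable
  have "(\<lambda>x. canonical_parent x (parent \<omega>)) = parent \<omega>" for \<omega> :: "nat \<times> (int ^ 'd) \<Rightarrow> real"
    by (simp add: fun_eq_iff canonical_parent_parent)
  then show ?thesis
    using measure_distr[OF measurable_parent_law sets[unfolded sets_parent_law]]
    by (simp add: ancestral_height_ge_iff parent_law_def[symmetric] vimage_def)
qed

theorem theorem2:
  assumes "CARD('d::finite) \<ge> 2"
  shows "\<exists>(M :: (int ^ 'd \<Rightarrow> int ^ 'd) measure) (a :: int ^ 'd \<Rightarrow> (int ^ 'd \<Rightarrow> int ^ 'd) \<Rightarrow> int ^ 'd).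
           prob_space M \<and>
           ancestral_function M a \<and>
           stationary M a \<and>
           directed M a \<and>
           polynomially_mixing M (count_space UNIV) a 1 \<and>
           limsup (\<lambda>n. ereal (real n ^ (CARD('d) - 1) *
             measure M {\<omega> \<in> space M. ancestral_height (\<lambda>x. a x \<omega>) 0 \<ge> enat n})) < \<infinity>"
proof (intro exI conjI)
  let ?h = "\<lambda>n. ereal (real n ^ (CARD('d) - 1) * measure parent_law
      {\<eta> \<in> space parent_law. enat n \<le> ancestral_height (\<lambda>x. canonical_parent x \<eta>) (0 :: int ^ 'd)})"
  have "limsup ?h \<le> ereal ((2 * real CARD('d)) ^ CARD('d) * trap_const CARD('d))"
    unfolding measure_height_canonical_parent
    by (intro Limsup_bounded eventually_sequentiallyI[of "CARD('d)"]) (simp only: ereal_less_eq ancestor_decay)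
  also have "\<dots> < \<infinity>" by simp
  finally show "limsup ?h < \<infinity>" .
qed (rule prob_space_parent_law ancestral_function_canonical_parent stationary_canonical_parent
    directed_canonical_parent polynomially_mixing_canonical_parent)+

end
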